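(* For every constant $\zeta>0$ there is a constant $C=C(\zeta)>0$ such that the following holds. Let $\alpha,\beta,\varepsilon\in(0,1)$. Let $\mathcal{H}$ be a set of $m$ distributions and let $P$ be a distribution with $d_{\mathrm{TV}}(P,\mathcal{H})=\mathrm{OPT}$. There is an $\varepsilon$-differentially private algorithm which takes as input $n$ independent samples from $P$ and with probability at least $1-\beta$ outputs a distribution $\hat H\in\mathcal{H}$ with $d_{\mathrm{TV}}(P,\hat H)\le 18(3+\zeta)\mathrm{OPT}+\alpha$, as long as \[n\ge C\left(\frac{\log(m/\beta)+\log\log(1/\alpha)}{\alpha^2}+\frac{\log m+\log^2(1/\alpha)\cdot(\log(1/\beta)+\log\log(1/\alpha))}{\alpha\varepsilon}\right).\] The running time of the algorithm is $O(m^2n\log(1/\alpha)+n\log^2(1/\alpha))$.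
   Context: $d_{\mathrm{TV}}$ is total variation distance and $d_{\mathrm{TV}}(P,\mathcal{H})=\inf_{H\in\mathcal{H}}d_{\mathrm{TV}}(P,H)$. Hypotheses are given by densities; running time is measured in a model where membership in sets $\{x:H(x)>H'(x)\}$ and the masses of such sets under $H,H'$ are computable in unit time. Neighboring datasets differ in at most one element; an algorithm $T$ is $\varepsilon$-differentially private if $\Pr[T(D)\in S]\le e^{\varepsilon}\Pr[T(D')\in S]$ for all neighboring $D,D'$ and all events $S$.
   Formalization: log(1/α) is read as max(1, ln(1/α)) in the sample bound, in loglog(1/α) and in the running time; taken literally, loglog(1/α) tends to minus infinity as α tends to 1, which would permit n = 0, where the claim fails. *)

theory Defs
  imports "HOL-Probability.Probability"
begin

section \<open>Total variation distance\<close>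

definition tv_dist :: "'x measure \<Rightarrow> 'x measure \<Rightarrow> real" where
  "tv_dist P Q = (SUP A\<in>sets P. \<bar>measure P A - measure Q A\<bar>)"

definition tv_dist_class :: "'x measure \<Rightarrow> 'x measure set \<Rightarrow> real" where
  "tv_dist_class P \<H> = (INF H\<in>\<H>. tv_dist P H)"


section \<open>Hypotheses given by densities\<close>

text \<open>
  A hypothesis class of \<open>m\<close> distributions is an enumeration \<open>h 0, \<dots>, h (m - 1)\<close> of densities with
  respect to a common reference measure; repetitions are not excluded.  The values \<open>h i\<close> for
  \<open>i \<ge> m\<close> are irrelevant: no instruction of the machine below can access them.
\<close>

definition hyp :: "'x measure \<Rightarrow> (nat \<Rightarrow> 'x \<Rightarrow> real) \<Rightarrow> nat \<Rightarrow> 'x measure" where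
  "hyp \<mu> h i = density \<mu> (\<lambda>x. ennreal (h i x))"

definition hypothesis_class :: "'x measure \<Rightarrow> nat \<Rightarrow> (nat \<Rightarrow> 'x \<Rightarrow> real) \<Rightarrow> bool" where
  "hypothesis_class \<mu> m h \<longleftrightarrow>
     (\<forall>i<m. h i \<in> borel_measurable \<mu> \<and> (\<forall>x\<in>space \<mu>. 0 \<le> h i x) \<and> prob_space (hyp \<mu> h i))"

definition scheffe_set :: "'x measure \<Rightarrow> (nat \<Rightarrow> 'x \<Rightarrow> real) \<Rightarrow> nat \<Rightarrow> nat \<Rightarrow> 'x set" where
  "scheffe_set \<mu> h i j = {x \<in> space \<mu>. h i x > h j x}"


section \<open>Randomized real-number RAM with access to Scheffe sets\<close>

text \<open>
  The machine has an integer memory, a real memory (both with indirect addressing) and a tape of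
  independent uniform random reals.  The data and the hypotheses can only be inspected through an
  oracle.  For a sample \<open>D 0, \<dots>, D (n - 1)\<close> it answers:
  is \<open>D k\<close> in \<open>{H\<^sub>i > H\<^sub>j}\<close>, and what is the mass of \<open>{H\<^sub>i > H\<^sub>j}\<close> under \<open>H\<^sub>i\<close> and under \<open>H\<^sub>j\<close>?
  Queries with an index out of range return a constant.
\<close>

record oracle_access =
  ask_mem :: "nat \<Rightarrow> nat \<Rightarrow> nat \<Rightarrow> bool"
  ask_mass_fst :: "nat \<Rightarrow> nat \<Rightarrow> real"
  ask_mass_snd :: "nat \<Rightarrow> nat \<Rightarrow> real"

definition scheffe_access ::
  "'x measure \<Rightarrow> nat \<Rightarrow> (nat \<Rightarrow> 'x \<Rightarrow> real) \<Rightarrow> nat \<Rightarrow> (nat \<Rightarrow> 'x) \<Rightarrow> oracle_access" where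
  "scheffe_access \<mu> m h n D =
     \<lparr> ask_mem = (\<lambda>i j k. i < m \<and> j < m \<and> k < n \<and> D k \<in> scheffe_set \<mu> h i j),
       ask_mass_fst = (\<lambda>i j. if i < m \<and> j < m then measure (hyp \<mu> h i) (scheffe_set \<mu> h i j) else 0),
       ask_mass_snd = (\<lambda>i j. if i < m \<and> j < m then measure (hyp \<mu> h j) (scheffe_set \<mu> h i j) else 0) \<rparr>"

text \<open>
  All operands are addresses, except for the constants of \<open>IConst\<close> and \<open>RConst\<close>.  There is
  deliberately no rounding from reals to integers and no integer multiplication, which at unit cost
  would make the machine unreasonably powerful.
\<close>

datatype instr =
    IConst nat nat
  | IAdd nat nat nat
  | ISub nat nat nat
  | ILoad nat nat
  | IStore nat nat
  | RConst nat real
  | RAdd nat nat nat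
  | RSub nat nat nat
  | RMul nat nat nat
  | RDiv nat nat nat
  | RExp nat nat
  | RLn nat nat
  | RLoad nat nat
  | RStore nat nat
  | RNat nat nat
  | Uniform nat
  | Member nat nat nat nat
  | MassFst nat nat nat
  | MassSnd nat nat nat

datatype test = ILess nat nat | RLess nat nat

datatype prog =
    Do instr
  | Skip
  | Seq prog prog
  | If test prog prog
  | While test prog

record state =
  ints :: "nat \<Rightarrow> nat"
  reals :: "nat \<Rightarrow> real"
  draws :: nat

abbreviation set_int :: "nat \<Rightarrow> nat \<Rightarrow> state \<Rightarrow> state" where
  "set_int a v s \<equiv> s\<lparr>ints := (ints s)(a := v)\<rparr>"

abbreviation set_real :: "nat \<Rightarrow> real \<Rightarrow> state \<Rightarrow> state" where
  "set_real a v s \<equiv> s\<lparr>reals := (reals s)(a := v)\<rparr>"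

fun exec_instr :: "oracle_access \<Rightarrow> (nat \<Rightarrow> real) \<Rightarrow> instr \<Rightarrow> state \<Rightarrow> state" where
  "exec_instr \<Omega> \<omega> (IConst a c) s = set_int a c s"
| "exec_instr \<Omega> \<omega> (IAdd a b c) s = set_int a (ints s b + ints s c) s"
| "exec_instr \<Omega> \<omega> (ISub a b c) s = set_int a (ints s b - ints s c) s"
| "exec_instr \<Omega> \<omega> (ILoad a b) s = set_int a (ints s (ints s b)) s"
| "exec_instr \<Omega> \<omega> (IStore a b) s = set_int (ints s a) (ints s b) s"
| "exec_instr \<Omega> \<omega> (RConst a c) s = set_real a c s"
| "exec_instr \<Omega> \<omega> (RAdd a b c) s = set_real a (reals s b + reals s c) s"
| "exec_instr \<Omega> \<omega> (RSub a b c) s = set_real a (reals s b - reals s c) s"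
| "exec_instr \<Omega> \<omega> (RMul a b c) s = set_real a (reals s b * reals s c) s"
| "exec_instr \<Omega> \<omega> (RDiv a b c) s = set_real a (reals s b / reals s c) s"
| "exec_instr \<Omega> \<omega> (RExp a b) s = set_real a (exp (reals s b)) s"
| "exec_instr \<Omega> \<omega> (RLn a b) s = set_real a (ln (reals s b)) s"
| "exec_instr \<Omega> \<omega> (RLoad a b) s = set_real a (reals s (ints s b)) s"
| "exec_instr \<Omega> \<omega> (RStore a b) s = set_real (ints s a) (reals s b) s"
| "exec_instr \<Omega> \<omega> (RNat a b) s = set_real a (real (ints s b)) s"
| "exec_instr \<Omega> \<omega> (Uniform a) s = (set_real a (\<omega> (draws s)) s)\<lparr>draws := Suc (draws s)\<rparr>"
| "exec_instr \<Omega> \<omega> (Member a b c d) s =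
     set_int a (if ask_mem \<Omega> (ints s b) (ints s c) (ints s d) then 1 else 0) s"
| "exec_instr \<Omega> \<omega> (MassFst a b c) s = set_real a (ask_mass_fst \<Omega> (ints s b) (ints s c)) s"
| "exec_instr \<Omega> \<omega> (MassSnd a b c) s = set_real a (ask_mass_snd \<Omega> (ints s b) (ints s c)) s"

fun holds :: "test \<Rightarrow> state \<Rightarrow> bool" where
  "holds (ILess a b) s \<longleftrightarrow> ints s a < ints s b"
| "holds (RLess a b) s \<longleftrightarrow> reals s a < reals s b"

text \<open>
  A configuration is a stack of programs still to be executed, together with the state.  Each
  application of \<open>step\<close> costs one unit of time, and the machine has halted once the stack is empty.
\<close>

fun step :: "oracle_access \<Rightarrow> (nat \<Rightarrow> real) \<Rightarrow> prog list \<times> state \<Rightarrow> prog list \<times> state" where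
  "step \<Omega> \<omega> ([], s) = ([], s)"
| "step \<Omega> \<omega> (Do i # K, s) = (K, exec_instr \<Omega> \<omega> i s)"
| "step \<Omega> \<omega> (Skip # K, s) = (K, s)"
| "step \<Omega> \<omega> (Seq p q # K, s) = (p # q # K, s)"
| "step \<Omega> \<omega> (If b p q # K, s) = ((if holds b s then p else q) # K, s)"
| "step \<Omega> \<omega> (While b p # K, s) = (if holds b s then p # While b p # K else K, s)"

text \<open>The integer inputs are \<open>m\<close> and \<open>n\<close>, the real inputs are \<open>\<alpha>\<close>, \<open>\<beta>\<close> and \<open>\<epsilon>\<close>.\<close>

definition init_state :: "real \<Rightarrow> real \<Rightarrow> real \<Rightarrow> nat \<Rightarrow> nat \<Rightarrow> state" where
  "init_state \<alpha> \<beta> \<epsilon> m n =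
     \<lparr> ints = (\<lambda>_. 0)(0 := m, 1 := n), reals = (\<lambda>_. 0)(0 := \<alpha>, 1 := \<beta>, 2 := \<epsilon>), draws = 0 \<rparr>"

definition config_after :: "prog \<Rightarrow> oracle_access \<Rightarrow> (nat \<Rightarrow> real) \<Rightarrow> state \<Rightarrow> nat \<Rightarrow> prog list \<times> state" where
  "config_after p \<Omega> \<omega> s t = (step \<Omega> \<omega> ^^ t) ([p], s)"

definition halted_at :: "prog \<Rightarrow> oracle_access \<Rightarrow> (nat \<Rightarrow> real) \<Rightarrow> state \<Rightarrow> nat \<Rightarrow> bool" where
  "halted_at p \<Omega> \<omega> s t \<longleftrightarrow> fst (config_after p \<Omega> \<omega> s t) = []"

definition runs_within :: "prog \<Rightarrow> oracle_access \<Rightarrow> (nat \<Rightarrow> real) \<Rightarrow> state \<Rightarrow> real \<Rightarrow> bool" where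
  "runs_within p \<Omega> \<omega> s b \<longleftrightarrow> (\<exists>t. halted_at p \<Omega> \<omega> s t \<and> real t \<le> b)"

text \<open>The output is the content of integer cell 0 upon halting, or \<open>None\<close> if the run diverges.\<close>

definition output_of :: "prog \<Rightarrow> oracle_access \<Rightarrow> (nat \<Rightarrow> real) \<Rightarrow> state \<Rightarrow> nat option" where
  "output_of p \<Omega> \<omega> s =
     (if \<exists>t. halted_at p \<Omega> \<omega> s t
      then Some (ints (snd (config_after p \<Omega> \<omega> s (LEAST t. halted_at p \<Omega> \<omega> s t))) 0)
      else None)"

definition random_tape :: "(nat \<Rightarrow> real) measure" where
  "random_tape = (\<Pi>\<^sub>M _\<in>UNIV. uniform_measure lborel {0..1})"


section \<open>Differential privacy\<close>

definition datasets :: "nat \<Rightarrow> 'x measure \<Rightarrow> (nat \<Rightarrow> 'x) set" where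
  "datasets n \<mu> = ({..<n} \<rightarrow>\<^sub>E space \<mu>)"

definition neighbouring :: "nat \<Rightarrow> (nat \<Rightarrow> 'x) \<Rightarrow> (nat \<Rightarrow> 'x) \<Rightarrow> bool" where
  "neighbouring n D D' \<longleftrightarrow> card {k. k < n \<and> D k \<noteq> D' k} \<le> 1"

text \<open>
  A randomized algorithm is a function \<open>T\<close> of the dataset and of the outcome \<open>\<omega>\<close> of an internal
  source of randomness \<open>R\<close>.  Since \<^const>\<open>measure\<close> vanishes on non-measurable sets, measurability
  of \<open>T D\<close> has to be demanded explicitly.
\<close>

definition differentially_private ::
  "real \<Rightarrow> nat \<Rightarrow> 'x measure \<Rightarrow> 'r measure \<Rightarrow> ((nat \<Rightarrow> 'x) \<Rightarrow> 'r \<Rightarrow> 'o) \<Rightarrow> bool" where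
  "differentially_private \<epsilon> n \<mu> R T \<longleftrightarrow>
     (\<forall>D\<in>datasets n \<mu>. T D \<in> measurable R (count_space UNIV)) \<and>
     (\<forall>D\<in>datasets n \<mu>. \<forall>D'\<in>datasets n \<mu>. neighbouring n D D' \<longrightarrow>
        (\<forall>S. measure R {\<omega>\<in>space R. T D \<omega> \<in> S} \<le> exp \<epsilon> * measure R {\<omega>\<in>space R. T D' \<omega> \<in> S}))"


section \<open>Sample size\<close>

text \<open>
  \<open>log(1/\<alpha>)\<close> in asymptotic bounds is read as at least 1, so that \<open>log log(1/\<alpha>)\<close> is nonnegative.
  For \<open>\<alpha> \<le> 1/e\<close> this is literally \<open>ln (1/\<alpha>)\<close>.
\<close>

definition log_inv :: "real \<Rightarrow> real" where
  "log_inv \<alpha> = max 1 (ln (1 / \<alpha>))"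

definition sample_bound :: "real \<Rightarrow> real \<Rightarrow> real \<Rightarrow> nat \<Rightarrow> real" where
  "sample_bound \<alpha> \<beta> \<epsilon> m =
     (ln (real m / \<beta>) + ln (log_inv \<alpha>)) / \<alpha>\<^sup>2
     + (ln (real m) + (log_inv \<alpha>)\<^sup>2 * (ln (1 / \<beta>) + ln (log_inv \<alpha>))) / (\<alpha> * \<epsilon>)"

end

(*
  The score of H_i is the largest discrepancy between the H_i-mass and the empirical frequency of a
  Scheffe set {H_i > H_j}, multiplied by n.  Exchanging one sample point moves every score by at
  most 1, so choosing i with probability proportional to exp(-eps * score / 2) is eps-private.  By
  Hoeffding's inequality all empirical frequencies are accurate up to alpha/8, the chosen score
  exceeds that of the best hypothesis by at most alpha * n / 4, and Yatracos' minimum distance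
  argument, applied to the Scheffe set of the chosen hypothesis against the best one, bounds the
  distance by 3 OPT + alpha/2.  For m = 1, where the sample bound may be arbitrarily small, there is
  nothing to choose.
*)
theory Submission
  imports Defs
begin

section \<open>Timed correctness of machine programs\<close>

text \<open>The mechanism consumes a single uniform number: its output is a function of the data and
  the first tape cell, obtained by inverting the cumulative distribution of the weights. The machine
  part therefore ends in an equation for the output valid on every tape, with a time bound free of
  the tape, and the rest concerns ratios of finite sums of weights. The factor 1/2 in the exponent
  pays for privacy: a neighbouring dataset changes both the weight of an index and the normalizing
  sum, each by a factor of at most exp(eps/2). A score uses only the mass under H_i, although the
  distance from H_i to the best H_b involves both. This suffices because the score of i covers the
  set {H_i > H_b}, where the empirical frequency is close to P and P is within OPT of H_b. The
  failure probability is split evenly: beta/2 for a union bound over the m^2 Scheffe sets, beta/2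
  for the selection. The time m^2 n comes from m scores, each a maximum over m sets, each counted
  with n membership queries.\<close>

definition reaches ::
  "oracle_access \<Rightarrow> (nat \<Rightarrow> real) \<Rightarrow> prog \<Rightarrow> state \<Rightarrow> nat \<Rightarrow> (state \<Rightarrow> bool) \<Rightarrow> bool" where
  "reaches \<Omega> \<omega> p s t Q \<longleftrightarrow>
     (\<exists>t'\<le>t. \<exists>s'. (\<forall>K. (step \<Omega> \<omega> ^^ t') (p # K, s) = (K, s')) \<and> Q s')"

lemma reaches_mono:
  assumes "reaches \<Omega> \<omega> p s t Q" "t \<le> t'" "\<And>s'. Q s' \<Longrightarrow> Q' s'"
  shows "reaches \<Omega> \<omega> p s t' Q'"
  using assms unfolding reaches_def by (meson le_trans)

lemma reaches_Do: "Q (exec_instr \<Omega> \<omega> i s) \<Longrightarrow> 0 < t \<Longrightarrow> reaches \<Omega> \<omega> (Do i) s t Q"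
  unfolding reaches_def by (intro exI[of _ 1]) auto

lemma reaches_Skip: "Q s \<Longrightarrow> 0 < t \<Longrightarrow> reaches \<Omega> \<omega> Skip s t Q"
  unfolding reaches_def by (intro exI[of _ 1]) auto

text \<open>In \<open>reaches\<close> the final state is chosen before the continuation
  \<open>K\<close>, so the run of \<open>p\<close> may be instantiated at the stack
  \<open>q # K\<close>. The extra unit of time pays for unfolding \<open>Seq\<close>.\<close>

lemma reaches_Seq:
  assumes "reaches \<Omega> \<omega> p s t (\<lambda>s'. reaches \<Omega> \<omega> q s' t' Q)"
  shows "reaches \<Omega> \<omega> (Seq p q) s (Suc (t + t')) Q"
proof -
  obtain t1 s1 where 1: "t1 \<le> t" "\<And>K. (step \<Omega> \<omega> ^^ t1) (p # K, s) = (K, s1)"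
    and w: "reaches \<Omega> \<omega> q s1 t' Q"
    using assms unfolding reaches_def[of _ _ p] by blast
  obtain t2 s2 where 2: "t2 \<le> t'" "\<And>K. (step \<Omega> \<omega> ^^ t2) (q # K, s1) = (K, s2)" "Q s2"
    using w unfolding reaches_def by blast
  have "(step \<Omega> \<omega> ^^ Suc (t2 + t1)) (Seq p q # K, s) = (K, s2)" for K
    by (simp only: funpow_Suc_right funpow_add o_apply step.simps 1 2)
  with 1 2 show ?thesis
    unfolding reaches_def by (intro exI[of _ "Suc (t2 + t1)"]) auto
qed

lemma reaches_If:
  assumes "holds b s \<Longrightarrow> reaches \<Omega> \<omega> p s t Q" "\<not> holds b s \<Longrightarrow> reaches \<Omega> \<omega> q s t Q"
  shows "reaches \<Omega> \<omega> (If b p q) s (Suc t) Q"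
proof -
  have "reaches \<Omega> \<omega> (if holds b s then p else q) s t Q"
    using assms by simp
  then obtain t1 s1 where "t1 \<le> t"
    "\<And>K. (step \<Omega> \<omega> ^^ t1) ((if holds b s then p else q) # K, s) = (K, s1)" "Q s1"
    unfolding reaches_def by blast
  then show ?thesis
    unfolding reaches_def
    by (intro exI[of _ "Suc t1"]) (auto simp only: funpow_Suc_right o_apply step.simps)
qed

lemma reaches_While_False:
  assumes "\<not> holds b s" "Q s" "0 < t"
  shows "reaches \<Omega> \<omega> (While b p) s t Q"
  unfolding reaches_def using assms by (intro exI[of _ 1]) auto

lemma reaches_While_True:
  assumes "holds b s" "reaches \<Omega> \<omega> p s t (\<lambda>s'. reaches \<Omega> \<omega> (While b p) s' t' Q)"
  shows "reaches \<Omega> \<omega> (While b p) s (Suc (t + t')) Q"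
proof -
  obtain t1 s1 where 1: "t1 \<le> t" "\<And>K. (step \<Omega> \<omega> ^^ t1) (p # K, s) = (K, s1)"
    and w: "reaches \<Omega> \<omega> (While b p) s1 t' Q"
    using assms(2) unfolding reaches_def[of _ _ p] by blast
  obtain t2 s2 where 2: "t2 \<le> t'" "\<And>K. (step \<Omega> \<omega> ^^ t2) (While b p # K, s1) = (K, s2)" "Q s2"
    using w unfolding reaches_def by blast
  have "(step \<Omega> \<omega> ^^ Suc (t2 + t1)) (While b p # K, s) = (K, s2)" for K
    by (simp only: funpow_Suc_right funpow_add o_apply step.simps if_True 1 2 assms(1))
  with 1 2 show ?thesis
    unfolding reaches_def by (intro exI[of _ "Suc (t2 + t1)"]) auto
qed

text \<open>The invariant carries the number of completed rounds. A round costs \<open>t\<close>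
  plus one for its test, and the failing test at the end costs one more.\<close>

lemma reaches_loop:
  assumes init: "I 0 s"
    and body: "\<And>c s. c < N \<Longrightarrow> I c s \<Longrightarrow> holds b s \<and> reaches \<Omega> \<omega> p s t (I (Suc c))"
    and exit: "\<And>s. I N s \<Longrightarrow> \<not> holds b s"
  shows "reaches \<Omega> \<omega> (While b p) s (Suc (N * Suc t)) (I N)"
proof -
  \<comment> \<open>Induction on the number \<open>d\<close> of rounds still to come.\<close>
  have "reaches \<Omega> \<omega> (While b p) s (Suc (d * Suc t)) (I N)" if "I (N - d) s" "d \<le> N" for d s
    using that
  proof (induction d arbitrary: s)
    case 0
    then show ?case
      using exit by (auto intro: reaches_While_False)
  next
    case (Suc d)
    have "Suc (N - Suc d) = N - d"
      using Suc.prems by simp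
    with body[of "N - Suc d" s] Suc.prems
    have "holds b s" and step: "reaches \<Omega> \<omega> p s t (I (N - d))"
      by simp_all
    have "reaches \<Omega> \<omega> p s t (\<lambda>s'. reaches \<Omega> \<omega> (While b p) s' (Suc (d * Suc t)) (I N))"
      by (rule reaches_mono[OF step]) (use Suc in auto)
    from reaches_While_True[OF \<open>holds b s\<close> this] show ?case
      by (simp add: algebra_simps)
  qed
  from this[of N s] init show ?thesis
    by simp
qed

fun block :: "instr list \<Rightarrow> prog" where
  "block [] = Skip"
| "block (i # is) = Seq (Do i) (block is)"

declare block.simps [simp del]

text \<open>Each instruction costs two units, one for unfolding \<open>Seq\<close> and one for
  execution; the closing \<open>Skip\<close> costs the last one.\<close>

lemma reaches_block:
  "Q (fold (exec_instr \<Omega> \<omega>) is s) \<Longrightarrow> reaches \<Omega> \<omega> (block is) s (2 * length is + 1) Q"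
proof (induction "is" arbitrary: s)
  case Nil
  then show ?case
    by (auto simp: block.simps intro: reaches_Skip)
next
  case (Cons i "is")
  then have "reaches \<Omega> \<omega> (Do i) s 1 (\<lambda>s'. reaches \<Omega> \<omega> (block is) s' (2 * length is + 1) Q)"
    by (intro reaches_Do) simp_all
  from reaches_Seq[OF this] show ?case
    by (simp add: block.simps)
qed

text \<open>\<open>output_of\<close> reads the state at the least halting time, whereas
  \<open>reaches\<close> supplies some halting time. Both see the same state, since a halted
  configuration is a fixed point of \<open>step\<close>.\<close>

lemma reaches_run:
  assumes "reaches \<Omega> \<omega> p s t (\<lambda>s'. ints s' 0 = v)"
  shows "output_of p \<Omega> \<omega> s = Some v" and "real t \<le> b \<Longrightarrow> runs_within p \<Omega> \<omega> s b"
proof -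
  obtain t1 s1 where 1: "t1 \<le> t" "(step \<Omega> \<omega> ^^ t1) ([p], s) = ([], s1)" "ints s1 0 = v"
    using assms unfolding reaches_def by blast
  have halt: "halted_at p \<Omega> \<omega> s t1"
    using 1 by (simp add: halted_at_def config_after_def)
  then show "runs_within p \<Omega> \<omega> s b" if "real t \<le> b"
    using 1 that by (auto simp: runs_within_def intro!: exI[of _ t1])
  define l where "l = (LEAST t. halted_at p \<Omega> \<omega> s t)"
  have l: "halted_at p \<Omega> \<omega> s l" "l \<le> t1"
    unfolding l_def using halt by (auto intro: LeastI Least_le)
  obtain s2 where s2: "config_after p \<Omega> \<omega> s l = ([], s2)"
    using l by (cases "config_after p \<Omega> \<omega> s l") (auto simp: halted_at_def)
  have stuck: "(step \<Omega> \<omega> ^^ d) ([], s2) = ([], s2)" for d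
    by (induction d) auto
  have "(step \<Omega> \<omega> ^^ t1) ([p], s) = (step \<Omega> \<omega> ^^ (t1 - l)) ((step \<Omega> \<omega> ^^ l) ([p], s))"
    using l(2) by (simp flip: funpow_add[THEN fun_cong, unfolded o_apply])
  also have "\<dots> = ([], s2)"
    using s2 stuck by (simp add: config_after_def)
  finally have "s2 = s1"
    using 1 by simp
  then show "output_of p \<Omega> \<omega> s = Some v"
    using halt s2 1 by (auto simp: output_of_def l_def)
qed


section \<open>The exponential mechanism on the machine\<close>

text \<open>Starting from 0 matches the initial content of the machine register and does not alter a
  maximum of nonnegative discrepancies.\<close>

primrec run_max :: "(nat \<Rightarrow> real) \<Rightarrow> nat \<Rightarrow> real" where
  "run_max f 0 = 0"
| "run_max f (Suc N) = max (run_max f N) (f N)"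

definition hits :: "oracle_access \<Rightarrow> nat \<Rightarrow> nat \<Rightarrow> nat \<Rightarrow> nat" where
  "hits \<Omega> n i j = (\<Sum>k<n. of_bool (ask_mem \<Omega> i j k))"

text \<open>Working with counts instead of frequencies makes the sensitivity 1 and avoids dividing
  by \<open>n\<close>, which may be 0.\<close>

definition discrepancy :: "oracle_access \<Rightarrow> nat \<Rightarrow> nat \<Rightarrow> nat \<Rightarrow> real" where
  "discrepancy \<Omega> n i j = \<bar>real n * ask_mass_fst \<Omega> i j - real (hits \<Omega> n i j)\<bar>"

definition score :: "oracle_access \<Rightarrow> nat \<Rightarrow> nat \<Rightarrow> nat \<Rightarrow> real" where
  "score \<Omega> m n i = run_max (discrepancy \<Omega> n i) m"

definition weight :: "oracle_access \<Rightarrow> nat \<Rightarrow> nat \<Rightarrow> real \<Rightarrow> nat \<Rightarrow> real" where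
  "weight \<Omega> m n \<epsilon> i = exp (- (\<epsilon> * score \<Omega> m n i / 2))"

lemma hits_0: "hits \<Omega> 0 i j = 0"
  and hits_Suc: "hits \<Omega> (Suc n) i j = hits \<Omega> n i j + (if ask_mem \<Omega> i j n then 1 else 0)"
  by (auto simp: hits_def)

text \<open>For a uniform \<open>u\<close> in \<open>[0, 1)\<close> this returns \<open>i\<close> with probability proportional to \<open>w i\<close>.\<close>

definition select :: "(nat \<Rightarrow> real) \<Rightarrow> nat \<Rightarrow> real \<Rightarrow> nat" where
  "select w m u = (\<Sum>i<m. of_bool (sum w {..i} \<le> u * sum w {..<m}))"

text \<open>
  Integer cells: 0 output, 1 \<open>n\<close>, 2 \<open>i\<close>, 3 \<open>j\<close>, 4 \<open>k\<close>, 5 membership bit, 6 constant 1, 7 hits,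
  8 \<open>m\<close>, 9 pointer into the table of cumulative weights, 10 constant 0.
  Real cells: 2 \<open>\<epsilon>\<close>, 3 running maximum, 4 and 5 scratch, 6 cumulative weight, 7 selection
  threshold, 8 constant 0, from 16 on the table of cumulative weights.
\<close>

definition count_loop :: prog where
  "count_loop = While (ILess 4 1) (block [Member 5 2 3 4, IAdd 7 7 5, IAdd 4 4 6])"

definition score_body :: prog where
  "score_body =
     Seq (block [IConst 4 0, IConst 7 0])
    (Seq count_loop
    (Seq (block [MassFst 4 2 3, RNat 5 1, RMul 4 5 4, RNat 5 7, RSub 4 4 5, RSub 5 8 4, IAdd 3 3 6])
    (Seq (If (RLess 3 4) (Do (RAdd 3 4 8)) Skip)
         (If (RLess 3 5) (Do (RAdd 3 5 8)) Skip))))"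

definition score_loop :: prog where
  "score_loop = While (ILess 3 8) score_body"

definition weight_loop :: prog where
  "weight_loop = While (ILess 2 8)
     (Seq (block [RConst 3 0, IConst 3 0])
     (Seq score_loop
          (block [RMul 4 2 3, RConst 5 (-1/2), RMul 4 5 4, RExp 4 4, RAdd 6 6 4, RStore 9 6,
                  IAdd 9 9 6, IAdd 2 2 6])))"

definition select_loop :: prog where
  "select_loop = While (ILess 2 8)
     (Seq (block [RLoad 4 9])
     (Seq (If (RLess 7 4) Skip (Do (IAdd 0 0 6)))
          (block [IAdd 9 9 6, IAdd 2 2 6])))"

text \<open>Cell 0 holds \<open>m\<close> on entry and the output on exit, so \<open>m\<close> is
  copied to cell 8 by adding cell 10, which is zero from the start. The uniform draw is scaled by
  the total weight, which spares normalizing the table.\<close>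

definition mechanism :: prog where
  "mechanism =
     Seq (block [IAdd 8 0 10, IConst 0 0, IConst 6 1, IConst 9 16])
    (Seq weight_loop
    (Seq (block [IConst 2 0, IConst 9 16, Uniform 7, RMul 7 7 6])
         select_loop))"

text \<open>The frame condition that lets the specification of an inner loop be used inside the
  invariant of an outer one.\<close>

definition same_except :: "nat set \<Rightarrow> nat set \<Rightarrow> state \<Rightarrow> state \<Rightarrow> bool" where
  "same_except A B s s' \<longleftrightarrow>
     (\<forall>a. a \<notin> A \<longrightarrow> ints s' a = ints s a) \<and> (\<forall>a. a \<notin> B \<longrightarrow> reals s' a = reals s a) \<and>
     draws s' = draws s"

section \<open>Correctness and running time of the loops, from the innermost outwards\<close>

lemma count_loop_correct:
  assumes "ints s 4 = 0" "ints s 7 = 0" "ints s 6 = 1"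
  shows "reaches \<Omega> \<omega> count_loop s (8 * ints s 1 + 1)
    (\<lambda>s'. same_except {4, 5, 7} {} s s' \<and> ints s' 7 = hits \<Omega> (ints s 1) (ints s 2) (ints s 3))"
proof -
  define I where "I = (\<lambda>c (s'::state). same_except {4, 5, 7} {} s s' \<and> ints s' 4 = c \<and>
    ints s' 7 = hits \<Omega> c (ints s 2) (ints s 3))"
  have "reaches \<Omega> \<omega> count_loop s (Suc (ints s 1 * Suc 7)) (I (ints s 1))"
    unfolding count_loop_def
  proof (rule reaches_loop)
    show "I 0 s"
      using assms by (simp add: I_def same_except_def hits_0 hits_Suc)
    show "holds (ILess 4 1) s' \<and>
        reaches \<Omega> \<omega> (block [Member 5 2 3 4, IAdd 7 7 5, IAdd 4 4 6]) s' 7 (I (Suc c))"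
      if "c < ints s 1" "I c s'" for c s'
      using that assms
      by (auto simp: I_def same_except_def hits_0 hits_Suc
          intro!: reaches_mono[OF reaches_block[of "I (Suc c)"]])
  qed (auto simp: I_def same_except_def)
  then show ?thesis
    by (rule reaches_mono) (auto simp: I_def)
qed

text \<open>The instruction set has no absolute value: the running maximum is updated with the
  signed difference in cell 4 and then with its negative in cell 5. Adding the constant 0 in real
  cell 8 serves as a copy.\<close>

lemma score_body_correct:
  assumes "ints s 6 = 1" "reals s 8 = 0"
  shows "reaches \<Omega> \<omega> score_body s (8 * ints s 1 + 40)
    (\<lambda>s'. same_except {3, 4, 5, 7} {3, 4, 5} s s' \<and> ints s' 3 = Suc (ints s 3) \<and>
      reals s' 3 = max (reals s 3) (discrepancy \<Omega> (ints s 1) (ints s 2) (ints s 3)))"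
proof -
  let ?d = "real (ints s 1) * ask_mass_fst \<Omega> (ints s 2) (ints s 3)
    - real (hits \<Omega> (ints s 1) (ints s 2) (ints s 3))"
  let ?I3 = "\<lambda>s'. same_except {3, 4, 5, 7} {3, 4, 5} s s' \<and> ints s' 3 = Suc (ints s 3) \<and>
    reals s' 5 = - ?d"
  have "reaches \<Omega> \<omega> score_body s
    (Suc (5 + Suc (8 * ints s 1 + 1 + Suc (15 + Suc (2 + 2)))))
    (\<lambda>s'. same_except {3, 4, 5, 7} {3, 4, 5} s s' \<and> ints s' 3 = Suc (ints s 3) \<and>
      reals s' 3 = max (reals s 3) \<bar>?d\<bar>)" (is "reaches _ _ _ _ _ ?Q")
    unfolding score_body_def
  proof (rule reaches_Seq, rule reaches_mono[OF reaches_block[where Q = "\<lambda>s'.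
        same_except {4, 7} {} s s' \<and> ints s' 4 = 0 \<and> ints s' 7 = 0"]])
    fix s1 assume s1: "same_except {4, 7} {} s s1 \<and> ints s1 4 = 0 \<and> ints s1 7 = 0"
    have "reaches \<Omega> \<omega> count_loop s1 (8 * ints s 1 + 1) (\<lambda>s'. same_except {4, 5, 7} {} s s' \<and>
        ints s' 7 = hits \<Omega> (ints s 1) (ints s 2) (ints s 3))"
      using s1 assms
      by (intro reaches_mono[OF count_loop_correct]) (auto simp: same_except_def)
    then show "reaches \<Omega> \<omega> (Seq count_loop
      (Seq (block [MassFst 4 2 3, RNat 5 1, RMul 4 5 4, RNat 5 7, RSub 4 4 5, RSub 5 8 4, IAdd 3 3 6])
      (Seq (If (RLess 3 4) (Do (RAdd 3 4 8)) Skip)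
         (If (RLess 3 5) (Do (RAdd 3 5 8)) Skip)))) s1
      (Suc (8 * ints s 1 + 1 + Suc (15 + Suc (2 + 2)))) ?Q"
    proof (intro reaches_Seq, elim reaches_mono, goal_cases)
      case (2 s2)
      show ?case
      proof (rule reaches_Seq, rule reaches_mono[OF reaches_block[where Q = "\<lambda>s'. ?I3 s' \<and>
            reals s' 3 = reals s 3 \<and> reals s' 4 = ?d"]], goal_cases)
        case 1
        then show ?case
          using 2 assms by (auto simp: same_except_def)
      next
        case (3 s3)
        have "reaches \<Omega> \<omega> (If (RLess 3 4) (Do (RAdd 3 4 8)) Skip) s3 (Suc 1)
            (\<lambda>s'. ?I3 s' \<and> reals s' 3 = max (reals s 3) ?d)"
          using 3 assms
          by (intro reaches_If reaches_Do reaches_Skip) (auto simp: same_except_def)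
        then have "reaches \<Omega> \<omega> (If (RLess 3 4) (Do (RAdd 3 4 8)) Skip) s3 (Suc 1)
            (\<lambda>s'. reaches \<Omega> \<omega> (If (RLess 3 5) (Do (RAdd 3 5 8)) Skip) s' (Suc 1) ?Q)"
          by (rule reaches_mono)
            (use assms in \<open>auto simp: same_except_def intro!: reaches_If reaches_Do reaches_Skip\<close>)
        from reaches_Seq[OF this] show ?case
          by (simp add: numeral_2_eq_2)
      qed simp
    qed simp
  qed (auto simp: same_except_def)
  then show ?thesis
    by (rule reaches_mono) (auto simp: discrepancy_def)
qed

lemma score_loop_correct:
  assumes "ints s 6 = 1" "ints s 3 = 0" "reals s 8 = 0" "reals s 3 = 0"
  shows "reaches \<Omega> \<omega> score_loop s (ints s 8 * (8 * ints s 1 + 41) + 1)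
    (\<lambda>s'. same_except {3, 4, 5, 7} {3, 4, 5} s s' \<and>
      reals s' 3 = score \<Omega> (ints s 8) (ints s 1) (ints s 2))"
proof -
  define I where "I = (\<lambda>c (s'::state). same_except {3, 4, 5, 7} {3, 4, 5} s s' \<and> ints s' 3 = c \<and>
    reals s' 3 = run_max (discrepancy \<Omega> (ints s 1) (ints s 2)) c)"
  have "reaches \<Omega> \<omega> score_loop s (Suc (ints s 8 * Suc (8 * ints s 1 + 40))) (I (ints s 8))"
    unfolding score_loop_def
  proof (rule reaches_loop)
    show "I 0 s"
      using assms by (simp add: I_def same_except_def)
    show "holds (ILess 3 8) s' \<and> reaches \<Omega> \<omega> score_body s' (8 * ints s 1 + 40) (I (Suc c))"
      if "c < ints s 8" "I c s'" for c s'
      using that assms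
      by (auto simp: I_def same_except_def intro!: reaches_mono[OF score_body_correct])
  qed (auto simp: I_def same_except_def)
  then show ?thesis
    by (rule reaches_mono) (auto simp: I_def score_def)
qed

text \<open>The table of partial sums starts at real cell 16, above all scratch cells, so neither
  the indirect stores nor the inner loops disturb the other's data.\<close>

lemma weight_loop_correct:
  fixes \<Omega> :: oracle_access
  assumes "ints s 6 = 1" "ints s 2 = 0" "ints s 9 = 16" "reals s 8 = 0" "reals s 6 = 0"
  defines "w \<equiv> weight \<Omega> (ints s 8) (ints s 1) (reals s 2)"
  shows "reaches \<Omega> \<omega> weight_loop s (ints s 8 * (ints s 8 * (8 * ints s 1 + 41) + 26) + 1)
    (\<lambda>s'. (\<forall>a\<in>{0, 1, 6, 8}. ints s' a = ints s a) \<and> draws s' = draws s \<and>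
      reals s' 6 = sum w {..<ints s 8} \<and> (\<forall>i<ints s 8. reals s' (16 + i) = sum w {..i}))"
proof -
  define I where "I = (\<lambda>c (s'::state). (\<forall>a\<in>{0, 1, 6, 8}. ints s' a = ints s a) \<and> draws s' = draws s \<and>
    ints s' 2 = c \<and> ints s' 9 = 16 + c \<and> (\<forall>a\<in>{2, 8}. reals s' a = reals s a) \<and>
    reals s' 6 = sum w {..<c} \<and> (\<forall>i<c. reals s' (16 + i) = sum w {..i}))"
  have "reaches \<Omega> \<omega> weight_loop s
    (Suc (ints s 8 * Suc (Suc (5 + Suc ((ints s 8 * (8 * ints s 1 + 41) + 1) + 17))))) (I (ints s 8))"
    unfolding weight_loop_def
  proof (rule reaches_loop)
    show "I 0 s"
      using assms by (simp add: I_def)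
    show "\<not> holds (ILess 2 8) s'" if "I (ints s 8) s'" for s'
      using that by (simp add: I_def)
    fix c s' assume c: "c < ints s 8" "I c s'"
    let ?J = "\<lambda>s''. I c s'' \<and> reals s'' 3 = score \<Omega> (ints s 8) (ints s 1) c"
    have "reaches \<Omega> \<omega> (Seq (block [RConst 3 0, IConst 3 0])
     (Seq score_loop
          (block [RMul 4 2 3, RConst 5 (-1/2), RMul 4 5 4, RExp 4 4, RAdd 6 6 4, RStore 9 6,
                  IAdd 9 9 6, IAdd 2 2 6]))) s'
      (Suc (5 + Suc ((ints s 8 * (8 * ints s 1 + 41) + 1) + 17))) (I (Suc c))"
    proof (rule reaches_Seq, rule reaches_mono[OF reaches_block[where Q = "\<lambda>s''.
          I c s'' \<and> ints s'' 3 = 0 \<and> reals s'' 3 = 0"]], goal_cases)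
      case 1
      then show ?case
        using c by (simp add: I_def)
    next
      case (3 s1)
      then have "reaches \<Omega> \<omega> score_loop s1 (ints s 8 * (8 * ints s 1 + 41) + 1) ?J"
        using assms
        by (intro reaches_mono[OF score_loop_correct]) (auto simp: I_def same_except_def)
      then show ?case
      proof (intro reaches_Seq, elim reaches_mono, goal_cases)
        case (2 s2)
        show ?case
          by (rule reaches_mono[OF reaches_block[where Q = "I (Suc c)"]])
            (use 2 c assms in \<open>auto simp: I_def weight_def less_Suc_eq mult.commute
              simp flip: lessThan_Suc_atMost\<close>)
      qed simp
    qed simp
    with c show "holds (ILess 2 8) s' \<and> reaches \<Omega> \<omega> (Seq (block [RConst 3 0, IConst 3 0])
     (Seq score_loop
          (block [RMul 4 2 3, RConst 5 (-1/2), RMul 4 5 4, RExp 4 4, RAdd 6 6 4, RStore 9 6,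
                  IAdd 9 9 6, IAdd 2 2 6]))) s'
      (Suc (5 + Suc ((ints s 8 * (8 * ints s 1 + 41) + 1) + 17))) (I (Suc c))"
      by (simp add: I_def)
  qed
  then show ?thesis
    by (rule reaches_mono) (auto simp: I_def)
qed

lemma select_loop_correct:
  assumes "ints s 6 = 1" "ints s 0 = 0" "ints s 2 = 0" "ints s 9 = 16"
    and "reals s 7 = u * sum w {..<ints s 8}" "\<forall>i<ints s 8. reals s (16 + i) = sum w {..i}"
  shows "reaches \<Omega> \<omega> select_loop s (ints s 8 * 13 + 1) (\<lambda>s'. ints s' 0 = select w (ints s 8) u)"
proof -
  define I where "I = (\<lambda>c (s'::state). same_except {0, 2, 9} {4} s s' \<and> ints s' 2 = c \<and> ints s' 9 = 16 + c \<and>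
    ints s' 0 = (\<Sum>i<c. of_bool (sum w {..i} \<le> u * sum w {..<ints s 8})))"
  let ?p = "Seq (block [RLoad 4 9]) (Seq (If (RLess 7 4) Skip (Do (IAdd 0 0 6)))
          (block [IAdd 9 9 6, IAdd 2 2 6]))"
  have "reaches \<Omega> \<omega> select_loop s (Suc (ints s 8 * Suc (Suc (3 + Suc (2 + 5))))) (I (ints s 8))"
    unfolding select_loop_def
  proof (rule reaches_loop)
    show "I 0 s"
      using assms by (simp add: I_def same_except_def)
    show "\<not> holds (ILess 2 8) s'" if "I (ints s 8) s'" for s'
      using that by (simp add: I_def same_except_def)
    fix c s' assume c: "c < ints s 8" "I c s'"
    let ?J = "\<lambda>s'. same_except {0, 2, 9} {4} s s' \<and> ints s' 2 = c \<and> ints s' 9 = 16 + c \<and>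
      ints s' 0 = (\<Sum>i<Suc c. of_bool (sum w {..i} \<le> u * sum w {..<ints s 8}))"
    have "reaches \<Omega> \<omega> ?p s' (Suc (3 + Suc (2 + 5))) (I (Suc c))"
    proof (rule reaches_Seq, rule reaches_mono[OF reaches_block[where Q = "\<lambda>s''.
          I c s'' \<and> reals s'' 4 = sum w {..c}"]], goal_cases)
      case 1
      then show ?case
        using c assms by (simp add: I_def same_except_def)
    next
      case (3 s1)
      have s1: "I c s1" "reals s1 7 = u * sum w {..<ints s 8}" "reals s1 4 = sum w {..c}" "ints s1 6 = 1"
        using 3 assms by (simp_all add: I_def same_except_def)
      have "reaches \<Omega> \<omega> (If (RLess 7 4) Skip (Do (IAdd 0 0 6))) s1 (Suc 1) ?J"
        using s1 by (intro reaches_If reaches_Do reaches_Skip) (simp_all add: I_def same_except_def)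
      then have "reaches \<Omega> \<omega> (If (RLess 7 4) Skip (Do (IAdd 0 0 6))) s1 2 ?J"
        by (simp add: numeral_2_eq_2)
      then show ?case
      proof (intro reaches_Seq, elim reaches_mono, goal_cases)
        case (2 s2)
        show ?case
          by (rule reaches_mono[OF reaches_block[where Q = "I (Suc c)"]])
            (use 2 assms(1) in \<open>simp_all add: I_def same_except_def del: sum_of_bool_eq\<close>)
      qed simp
    qed simp
    with c show "holds (ILess 2 8) s' \<and> reaches \<Omega> \<omega> ?p s' (Suc (3 + Suc (2 + 5))) (I (Suc c))"
      by (simp add: I_def same_except_def)
  qed
  then show ?thesis
    by (rule reaches_mono) (auto simp: I_def select_def)
qed

text \<open>Nothing is assumed about the tape, so values outside the unit interval are covered as
  well; they matter for the time bound, which is demanded for every tape.\<close>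

lemma mechanism_correct:
  "reaches \<Omega> \<omega> mechanism (init_state \<alpha> \<beta> \<epsilon> m n)
    (m * (m * (8 * n + 41) + 39) + 25)
    (\<lambda>s'. ints s' 0 = select (weight \<Omega> m n \<epsilon>) m (\<omega> 0))"
proof -
  let ?w = "weight \<Omega> m n \<epsilon>"
  let ?T = "m * (m * (8 * n + 41) + 26) + 1"
  let ?I = "\<lambda>s'. ints s' 0 = 0 \<and> ints s' 6 = 1 \<and> ints s' 8 = m \<and> draws s' = 0 \<and>
    reals s' 6 = sum ?w {..<m} \<and> (\<forall>i<m. reals s' (16 + i) = sum ?w {..i})"
  have "reaches \<Omega> \<omega> mechanism (init_state \<alpha> \<beta> \<epsilon> m n)
    (Suc (9 + Suc (?T + Suc (9 + (m * 13 + 1)))))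
    (\<lambda>s'. ints s' 0 = select ?w m (\<omega> 0))"
    unfolding mechanism_def
  proof (rule reaches_Seq, rule reaches_mono[OF reaches_block[where Q = "\<lambda>s'.
          ints s' 0 = 0 \<and> ints s' 1 = n \<and> ints s' 2 = 0 \<and> ints s' 6 = 1 \<and> ints s' 8 = m \<and>
          ints s' 9 = 16 \<and> reals s' 2 = \<epsilon> \<and> reals s' 6 = 0 \<and> reals s' 8 = 0 \<and> draws s' = 0"]], goal_cases)
    case 1
    then show ?case
      by (simp add: init_state_def)
  next
    case (3 s1)
    then have "reaches \<Omega> \<omega> weight_loop s1 ?T ?I"
      by (intro reaches_mono[OF weight_loop_correct]) auto
    then show ?case
    proof (intro reaches_Seq, elim reaches_mono, goal_cases)
      case (2 s2)
      show ?case
      proof (rule reaches_Seq, rule reaches_mono[OF reaches_block[where Q = "\<lambda>s'. ints s' 0 = 0 \<and> ints s' 2 = 0 \<and>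
            ints s' 6 = 1 \<and> ints s' 8 = m \<and> ints s' 9 = 16 \<and>
            reals s' 7 = \<omega> 0 * sum ?w {..<m} \<and> (\<forall>i<m. reals s' (16 + i) = sum ?w {..i})"]], goal_cases)
        case 1
        then show ?case
          using 2 by simp
      next
        case (3 s3)
        then show ?case
          by (intro reaches_mono[OF select_loop_correct[where u = "\<omega> 0" and w = ?w]]) auto
      qed simp
    qed simp
  qed simp
  then show ?thesis
    by (rule reaches_mono) (auto simp: algebra_simps)
qed

section \<open>Bounds for running maxima\<close>

lemma run_max_nonneg: "0 \<le> run_max f N"
  by (induction N) auto

lemma run_max_ge: "i < N \<Longrightarrow> f i \<le> run_max f N"
  by (induction N) (auto simp: less_Suc_eq le_max_iff_disj)

lemma run_max_le: "0 \<le> c \<Longrightarrow> (\<And>i. i < N \<Longrightarrow> f i \<le> c) \<Longrightarrow> run_max f N \<le> c"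
  by (induction N) auto

lemma run_max_le_add:
  assumes "0 \<le> d" "\<And>i. i < N \<Longrightarrow> f i \<le> g i + d"
  shows "run_max f N \<le> run_max g N + d"
  using assms run_max_ge[of _ N g] run_max_nonneg[of g N]
  by (intro run_max_le) (force intro: order_trans)+

section \<open>Sampling by cumulative weights\<close>

text \<open>Partial sums of positive weights increase, so the indices counted by
  \<open>select\<close> form an initial segment \<open>{..<c}\<close>, and the count is the first
  index \<open>c\<close> whose partial sum exceeds the threshold.\<close>

lemma select_eq_iff:
  fixes w :: "nat \<Rightarrow> real"
  assumes w: "\<And>i. 0 < w i" and "i < m" "0 \<le> u" "u < 1"
  shows "select w m u = i \<longleftrightarrow> sum w {..<i} \<le> u * sum w {..<m} \<and> u * sum w {..<m} < sum w {..i}"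
proof -
  define x where "x = u * sum w {..<m}"
  define F where "F = (\<lambda>j. sum w {..j})"
  have F_mono: "F j \<le> F k" if "j \<le> k" for j k
    unfolding F_def by (intro sum_mono2) (use that w in \<open>auto intro: less_imp_le\<close>)
  have "0 < sum w {..<m}"
    using assms by (intro sum_pos) auto
  then have x: "0 \<le> x" "x < sum w {..<m}"
    using assms by (auto simp: x_def)
  \<comment> \<open>Here \<open>u < 1\<close> enters: the threshold lies strictly below the total,
    so the first index exceeding it is at most \<open>m - 1\<close>.\<close>
  have "F (m - 1) = sum w {..<m}"
    using \<open>i < m\<close> unfolding F_def by (intro arg_cong[where f = "sum w"]) auto
  then have ex: "x < F (m - 1)"
    using x by simp
  define c where "c = (LEAST j. x < F j)"
  have "x < F c"
    unfolding c_def by (rule LeastI[of "\<lambda>j. x < F j", OF ex])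
  have "c \<le> m - 1"
    unfolding c_def by (rule Least_le[of "\<lambda>j. x < F j", OF ex])
  have c: "F j \<le> x \<longleftrightarrow> j < c" for j
  proof
    show "j < c" if "F j \<le> x"
      using that \<open>x < F c\<close> F_mono[of c j] by (cases "j < c") auto
    show "F j \<le> x" if "j < c"
      using not_less_Least[of j "\<lambda>j. x < F j"] that by (auto simp: c_def)
  qed
  have "{..<m} \<inter> {j. j < c} = {..<c}"
    using \<open>c \<le> m - 1\<close> \<open>i < m\<close> by auto
  then have "(\<Sum>j<m. of_bool (j < c)) = c"
    by simp
  then have "select w m u = c"
    unfolding select_def by (simp only: c[unfolded x_def F_def])
  moreover have "sum w {..<i} \<le> x \<longleftrightarrow> i \<le> c"
  proof (cases i)
    case (Suc k)
    then show ?thesis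
      using c[of k] by (simp add: F_def lessThan_Suc_atMost Suc_le_eq)
  qed (use x in simp)
  moreover have "x < F i \<longleftrightarrow> c \<le> i"
    using c[of i] by auto
  ultimately show ?thesis
    by (auto simp: x_def F_def)
qed

section \<open>Measurability of the selection and its law under one tape cell\<close>

lemma measurable_count_space_real:
  fixes f :: "'a \<Rightarrow> nat"
  assumes "(\<lambda>x. real (f x)) \<in> borel_measurable M"
  shows "f \<in> measurable M (count_space UNIV)"
proof -
  have "f -` {a} \<inter> space M = (\<lambda>x. real (f x)) -` {real a} \<inter> space M" for a
    by auto
  also have "\<dots> a \<in> sets M" for a
    using assms by (rule measurable_sets) simp
  finally show ?thesis
    by (simp add: measurable_count_space_eq2_countable)
qed

lemma measurable_select:
  fixes w :: "'a \<Rightarrow> nat \<Rightarrow> real"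
  assumes [measurable]: "\<And>i. (\<lambda>x. w x i) \<in> borel_measurable M" "u \<in> borel_measurable M"
  shows "(\<lambda>x. select (w x) m (u x)) \<in> measurable M (count_space UNIV)"
proof (rule measurable_count_space_real)
  show "(\<lambda>x. real (select (w x) m (u x))) \<in> borel_measurable M"
    unfolding select_def of_nat_sum of_nat_of_bool by measurable
qed

lemma measurable_select_borel [measurable]: "select w m \<in> measurable borel (count_space UNIV)"
  by (rule measurable_select[of "\<lambda>_. w" borel "\<lambda>u. u" m]) auto

abbreviation unit_uniform :: "real measure" where
  "unit_uniform \<equiv> uniform_measure lborel {0..1}"

interpretation unit_uniform: prob_space unit_uniform
  by (rule prob_space_uniform_measure) auto

interpretation random_tape: prob_space random_tape
  unfolding random_tape_def by (intro prob_space_PiM unit_uniform.prob_space_axioms)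

lemma measurable_tape_cell [measurable]: "(\<lambda>\<omega>. \<omega> 0) \<in> borel_measurable random_tape"
proof -
  have "(\<lambda>\<omega>. \<omega> (0::nat)) \<in> measurable random_tape unit_uniform"
    unfolding random_tape_def by measurable
  then show ?thesis
    by (simp cong: measurable_cong_sets)
qed

lemma random_tape_cell: "distr random_tape borel (\<lambda>\<omega>. \<omega> 0) = unit_uniform"
proof -
  have "distr random_tape borel (\<lambda>\<omega>. \<omega> 0) = distr random_tape unit_uniform (\<lambda>\<omega>. \<omega> 0)"
    by (intro distr_cong refl) simp
  also have "\<dots> = unit_uniform"
    unfolding random_tape_def by (intro distr_PiM_component unit_uniform.prob_space_axioms) auto
  finally show ?thesis .
qed

text \<open>The tape is uniform on the closed interval; at the endpoint 1 the selection would return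
  the invalid index \<open>m\<close>, so this null event is removed.\<close>

lemma AE_unit_uniform: "AE u in unit_uniform. 0 \<le> u \<and> u < 1"
proof (rule AE_uniform_measureI)
  show "AE u in lborel. u \<in> {0..1} \<longrightarrow> 0 \<le> u \<and> u < (1::real)"
    using AE_lborel_singleton[of "1::real"] by eventually_elim auto
qed auto

text \<open>Up to a null set, index \<open>i\<close> is selected exactly when \<open>u\<close> lies
  between two consecutive normalized partial sums. This half-open interval lies in the unit interval
  and has length \<open>w i / sum w {..<m}\<close>.\<close>

lemma prob_select_eq:
  fixes w :: "nat \<Rightarrow> real"
  assumes w: "\<And>i. 0 < w i" and "i < m"
  shows "measure unit_uniform {u. select w m u = i} = w i / sum w {..<m}"
proof -
  have Z: "0 < sum w {..<m}"
    using assms by (intro sum_pos) auto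
  let ?I = "{sum w {..<i} / sum w {..<m} ..< sum w {..i} / sum w {..<m}}"
  have "measure unit_uniform {u. select w m u = i} = measure unit_uniform ?I"
  proof (rule unit_uniform.finite_measure_eq_AE)
    show "AE u in unit_uniform. u \<in> {u. select w m u = i} \<longleftrightarrow> u \<in> ?I"
      using AE_unit_uniform
    proof eventually_elim
      case (elim u)
      with select_eq_iff[OF w \<open>i < m\<close>, of u] Z show ?case
        by (simp add: pos_divide_le_eq pos_less_divide_eq)
    qed
    have "{u \<in> space borel. select w m u = i} \<in> sets borel"
      by measurable
    then show "{u. select w m u = i} \<in> sets unit_uniform"
      by simp
  qed simp
  also have "\<dots> = measure lborel ({0..1} \<inter> ?I)"
    by simp
  also have "{0..1} \<inter> ?I = ?I"
  proof -
    have "sum w {..i} \<le> sum w {..<m}"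
      using assms by (intro sum_mono2) (auto intro: less_imp_le)
    then have "sum w {..i} / sum w {..<m} \<le> 1"
      using Z by simp
    moreover have "0 \<le> sum w {..<i} / sum w {..<m}"
      using Z by (intro divide_nonneg_pos sum_nonneg less_imp_le w) auto
    ultimately show ?thesis
      by force
  qed
  also have "sum w {..i} / sum w {..<m} = sum w {..<i} / sum w {..<m} + w i / sum w {..<m}"
    by (simp add: add_divide_distrib flip: lessThan_Suc_atMost)
  also have "measure lborel {sum w {..<i} / sum w {..<m} ..< sum w {..<i} / sum w {..<m} + w i / sum w {..<m}}
    = w i / sum w {..<m}"
    using Z w[of i] by (simp add: measure_def less_imp_le)
  finally show ?thesis .
qed

lemma prob_select:
  fixes w :: "nat \<Rightarrow> real"
  assumes w: "\<And>i. 0 < w i" and "0 < m"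
  shows "measure random_tape {\<omega> \<in> space random_tape. Q (select w m (\<omega> 0))} =
    sum w {i. i < m \<and> Q i} / sum w {..<m}"
proof -
  have sets: "{u. R (select w m u)} \<in> sets borel" for R
  proof -
    have "{u \<in> space borel. R (select w m u)} \<in> sets borel"
      by measurable
    then show ?thesis
      by simp
  qed
  let ?U = "\<Union>i\<in>{i. i < m \<and> Q i}. {u. select w m u = i}"
  \<comment> \<open>The masses of the events for \<open>i < m\<close> already add up to 1, so values
    outside the range are null and the behaviour of \<open>Q\<close> there is irrelevant.\<close>
  have total: "measure unit_uniform {u. select w m u < m} = 1"
  proof -
    have "{u. select w m u < m} = (\<Union>i\<in>{..<m}. {u. select w m u = i})"
      by auto
    then have "measure unit_uniform {u. select w m u < m} = 
      (\<Sum>i<m. measure unit_uniform {u. select w m u = i})"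
      using sets by (simp only:)
        (intro unit_uniform.finite_measure_finite_Union, auto simp: disjoint_family_on_def)
    also have "\<dots> = sum w {..<m} / sum w {..<m}"
      unfolding sum_divide_distrib
      by (intro sum.cong) (simp_all add: prob_select_eq w del: measure_uniform_measure)
    also have "0 < sum w {..<m}"
      using assms by (intro sum_pos) auto
    then have "sum w {..<m} / sum w {..<m} = 1"
      by simp
    finally show ?thesis .
  qed
  have "measure random_tape {\<omega> \<in> space random_tape. Q (select w m (\<omega> 0))} =
    measure (distr random_tape borel (\<lambda>\<omega>. \<omega> 0)) {u. Q (select w m u)}"
    by (subst measure_distr) (auto simp: sets intro!: arg_cong[where f = "measure random_tape"])
  also have "\<dots> = measure unit_uniform {u. Q (select w m u)}"
    by (simp only: random_tape_cell)
  also have "\<dots> = measure unit_uniform ?U"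
  proof (rule unit_uniform.finite_measure_eq_AE)
    have "AE u in unit_uniform. u \<in> {u. select w m u < m}"
      using total sets by (intro unit_uniform.AE_prob_1) auto
    then show "AE u in unit_uniform. u \<in> {u. Q (select w m u)} \<longleftrightarrow> u \<in> ?U"
      by eventually_elim auto
  qed (auto simp: sets)
  also have "\<dots> = (\<Sum>i | i < m \<and> Q i. measure unit_uniform {u. select w m u = i})"
    using sets by (intro unit_uniform.finite_measure_finite_Union) (auto simp: disjoint_family_on_def)
  also have "\<dots> = sum w {i. i < m \<and> Q i} / sum w {..<m}"
    unfolding sum_divide_distrib
      by (intro sum.cong) (simp_all add: prob_select_eq w del: measure_uniform_measure)
  finally show ?thesis .
qed

text \<open>One factor \<open>exp d\<close> comes from the numerator and another from the
  normalizing sum; the two estimates are multiplied crosswise before dividing.\<close>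

lemma prob_select_ratio:
  fixes w w' :: "nat \<Rightarrow> real"
  assumes w: "\<And>i. 0 < w i" "\<And>i. 0 < w' i" and "0 < m"
    and le: "\<And>i. i < m \<Longrightarrow> w i \<le> exp d * w' i" "\<And>i. i < m \<Longrightarrow> w' i \<le> exp d * w i"
  shows "measure random_tape {\<omega> \<in> space random_tape. Q (select w m (\<omega> 0))}
    \<le> exp (2 * d) * measure random_tape {\<omega> \<in> space random_tape. Q (select w' m (\<omega> 0))}"
proof -
  have Z: "0 < sum w {..<m}" "0 < sum w' {..<m}"
    using assms by (auto intro!: sum_pos simp del: sum_pos)
  have "sum w {i. i < m \<and> Q i} \<le> exp d * sum w' {i. i < m \<and> Q i}"
    unfolding sum_distrib_left using le by (intro sum_mono) auto
  moreover have "sum w' {..<m} \<le> exp d * sum w {..<m}"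
    unfolding sum_distrib_left using le by (intro sum_mono) auto
  moreover have "0 \<le> sum w {i. i < m \<and> Q i}" "0 \<le> sum w' {i. i < m \<and> Q i}"
    using w by (simp_all add: sum_nonneg less_imp_le)
  ultimately have "sum w {i. i < m \<and> Q i} * sum w' {..<m}
      \<le> (exp d * sum w' {i. i < m \<and> Q i}) * (exp d * sum w {..<m})"
    using Z by (intro mult_mono) auto
  moreover have e: "exp (2 * d) = exp d * exp d"
    by (simp flip: exp_add)
  ultimately have "sum w {i. i < m \<and> Q i} / sum w {..<m}
      \<le> exp (2 * d) * (sum w' {i. i < m \<and> Q i} / sum w' {..<m})"
    unfolding e using Z by (simp add: divide_simps mult_ac)
  then show ?thesis
    using assms by (simp add: prob_select)
qed

section \<open>Privacy\<close>

lemma weight_pos: "0 < weight \<Omega> m n \<epsilon> i"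
  by (simp add: weight_def)

text \<open>Membership bits can differ only at positions where the datasets differ, so the counts
  differ by at most the number of such positions.\<close>

lemma hits_neighbouring:
  assumes "neighbouring n D D'"
  shows "real (hits (scheffe_access \<mu> m h n D) n i j) \<le> real (hits (scheffe_access \<mu> m h n D') n i j) + 1"
proof -
  let ?b = "\<lambda>D k. of_bool (ask_mem (scheffe_access \<mu> m h n D) i j k) :: nat"
  let ?d = "\<lambda>k. of_bool (D k \<noteq> D' k) :: nat"
  have "(\<Sum>k<n. ?b D k) \<le> (\<Sum>k<n. ?b D' k + ?d k)"
    by (intro sum_mono) (auto simp: scheffe_access_def)
  also have "\<dots> = (\<Sum>k<n. ?b D' k) + card {k. k < n \<and> D k \<noteq> D' k}"
    by (subst sum.distrib) (auto intro!: arg_cong[where f = card])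
  finally have "hits (scheffe_access \<mu> m h n D) n i j \<le> hits (scheffe_access \<mu> m h n D') n i j + 1"
    using assms unfolding hits_def neighbouring_def by linarith
  then show ?thesis
    by linarith
qed

lemma neighbouring_sym: "neighbouring n D D' \<Longrightarrow> neighbouring n D' D"
  by (simp add: neighbouring_def eq_commute)

text \<open>The masses do not depend on the data, so only the counts move, and a maximum moves by no
  more than its entries.\<close>

lemma score_neighbouring:
  assumes "neighbouring n D D'"
  shows "score (scheffe_access \<mu> m h n D) m n i \<le> score (scheffe_access \<mu> m h n D') m n i + 1"
  unfolding score_def
proof (rule run_max_le_add)
  fix j
  have mass: "ask_mass_fst (scheffe_access \<mu> m h n D) i j = ask_mass_fst (scheffe_access \<mu> m h n D') i j"
    by (simp add: scheffe_access_def)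
  show "discrepancy (scheffe_access \<mu> m h n D) n i j \<le> discrepancy (scheffe_access \<mu> m h n D') n i j + 1"
    using hits_neighbouring[OF assms, of \<mu> m h i j]
      hits_neighbouring[OF neighbouring_sym[OF assms], of \<mu> m h i j]
    unfolding discrepancy_def mass by linarith
qed simp

lemma weight_neighbouring:
  assumes "neighbouring n D D'" "0 \<le> \<epsilon>"
  shows "weight (scheffe_access \<mu> m h n D) m n \<epsilon> i
    \<le> exp (\<epsilon> / 2) * weight (scheffe_access \<mu> m h n D') m n \<epsilon> i"
proof -
  have "\<epsilon> * score (scheffe_access \<mu> m h n D') m n i \<le> \<epsilon> * (score (scheffe_access \<mu> m h n D) m n i + 1)"
    by (rule mult_left_mono[OF score_neighbouring[OF neighbouring_sym[OF assms(1)]] assms(2)])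
  then have "- (\<epsilon> * score (scheffe_access \<mu> m h n D) m n i / 2)
    \<le> \<epsilon> / 2 + - (\<epsilon> * score (scheffe_access \<mu> m h n D') m n i / 2)"
    unfolding distrib_left by linarith
  then show ?thesis
    by (simp only: weight_def exp_le_cancel_iff flip: exp_add)
qed

lemma output_mechanism:
  "output_of mechanism \<Omega> \<omega> (init_state \<alpha> \<beta> \<epsilon> m n) = Some (select (weight \<Omega> m n \<epsilon>) m (\<omega> 0))"
  by (rule reaches_run(1)[OF mechanism_correct])

lemma mechanism_private:
  assumes "0 \<le> \<epsilon>" "0 < m"
  shows "differentially_private \<epsilon> n \<mu> random_tape
    (\<lambda>D \<omega>. output_of mechanism (scheffe_access \<mu> m h n D) \<omega> (init_state \<alpha> \<beta> \<epsilon> m n))"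
  unfolding differentially_private_def output_mechanism
proof (intro conjI ballI impI allI)
  fix D
  have "(\<lambda>\<omega>. select (weight (scheffe_access \<mu> m h n D) m n \<epsilon>) m (\<omega> 0))
      \<in> measurable random_tape (count_space UNIV)"
    by measurable
  then show "(\<lambda>\<omega>. Some (select (weight (scheffe_access \<mu> m h n D) m n \<epsilon>) m (\<omega> 0)))
      \<in> measurable random_tape (count_space UNIV)"
    by (rule measurable_compose) simp
next
  fix D D' :: "nat \<Rightarrow> 'a" and S
  assume nb: "neighbouring n D D'"
  have "measure random_tape {\<omega> \<in> space random_tape.
      Some (select (weight (scheffe_access \<mu> m h n D) m n \<epsilon>) m (\<omega> 0)) \<in> S}
    \<le> exp (2 * (\<epsilon> / 2)) * measure random_tape {\<omega> \<in> space random_tape.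
      Some (select (weight (scheffe_access \<mu> m h n D') m n \<epsilon>) m (\<omega> 0)) \<in> S}"
    by (rule prob_select_ratio[where Q = "\<lambda>i. Some i \<in> S"])
      (use assms nb neighbouring_sym[OF nb] in \<open>auto intro: weight_pos weight_neighbouring\<close>)
  then show "measure random_tape {\<omega> \<in> space random_tape.
      Some (select (weight (scheffe_access \<mu> m h n D) m n \<epsilon>) m (\<omega> 0)) \<in> S}
    \<le> exp \<epsilon> * measure random_tape {\<omega> \<in> space random_tape.
      Some (select (weight (scheffe_access \<mu> m h n D') m n \<epsilon>) m (\<omega> 0)) \<in> S}"
    by simp
qed

text \<open>For positive \<open>m\<close> and \<open>n\<close> each monomial of the exact time bound
  is at most \<open>m * m * n\<close>, whence 113 = 8 + 41 + 39 + 25.\<close>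

lemma mechanism_time:
  assumes "0 < m" "0 < n"
  shows "runs_within mechanism \<Omega> \<omega> (init_state \<alpha> \<beta> \<epsilon> m n)
    (113 * ((real m)\<^sup>2 * real n * log_inv \<alpha> + real n * (log_inv \<alpha>)\<^sup>2))"
proof (rule reaches_run(2)[OF mechanism_correct])
  have "m * m \<le> m * m * n" "m \<le> m * m * n" "1 \<le> m * m * n"
    using assms by (auto simp: Suc_le_eq)
  moreover have "m * (m * (8 * n + 41) + 39) + 25 = 8 * (m * m * n) + 41 * (m * m) + 39 * m + 25"
    by (simp add: algebra_simps)
  ultimately have "m * (m * (8 * n + 41) + 39) + 25 \<le> 113 * (m * m * n)"
    by linarith
  then have "real (m * (m * (8 * n + 41) + 39) + 25) \<le> real (113 * (m * m * n))"
    by (simp only: of_nat_le_iff)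
  also have "\<dots> = 113 * ((real m)\<^sup>2 * real n * 1)"
    by (simp add: power2_eq_square)
  also have "\<dots> \<le> 113 * ((real m)\<^sup>2 * real n * log_inv \<alpha> + real n * (log_inv \<alpha>)\<^sup>2)"
    by (intro mult_left_mono add_increasing2) (auto simp: log_inv_def)
  finally show "real (m * (m * (8 * n + 41) + 39) + 25)
    \<le> 113 * ((real m)\<^sup>2 * real n * log_inv \<alpha> + real n * (log_inv \<alpha>)\<^sup>2)" .
qed


section \<open>Scheffe sets\<close>

lemma bdd_above_tv_dist:
  assumes "prob_space P" "prob_space Q"
  shows "bdd_above ((\<lambda>A. \<bar>measure P A - measure Q A\<bar>) ` sets P)"
proof (rule bdd_aboveI2)
  fix A
  show "\<bar>measure P A - measure Q A\<bar> \<le> 1"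
    using prob_space.prob_le_1[OF assms(1), of A] prob_space.prob_le_1[OF assms(2), of A]
      measure_nonneg[of P A] measure_nonneg[of Q A] by linarith
qed

lemma measure_diff_le_tv_dist:
  assumes "prob_space P" "prob_space Q" "A \<in> sets P"
  shows "\<bar>measure P A - measure Q A\<bar> \<le> tv_dist P Q"
  unfolding tv_dist_def using assms by (intro cSUP_upper bdd_above_tv_dist)

lemma tv_dist_le:
  assumes "\<And>A. A \<in> sets P \<Longrightarrow> \<bar>measure P A - measure Q A\<bar> \<le> c"
  shows "tv_dist P Q \<le> c"
  unfolding tv_dist_def by (rule cSUP_least) (use assms in auto)

context
  fixes \<mu> :: "'x measure" and m :: nat and h :: "nat \<Rightarrow> 'x \<Rightarrow> real"
  assumes hyps: "hypothesis_class \<mu> m h"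
begin

lemma prob_space_hyp: "i < m \<Longrightarrow> prob_space (hyp \<mu> h i)"
  using hyps by (simp add: hypothesis_class_def)

lemma sets_hyp [simp]: "sets (hyp \<mu> h i) = sets \<mu>"
  and space_hyp [simp]: "space (hyp \<mu> h i) = space \<mu>"
  by (simp_all add: hyp_def)

lemma measurable_hyp: "i < m \<Longrightarrow> h i \<in> borel_measurable \<mu>"
  using hyps by (simp add: hypothesis_class_def)

lemma scheffe_set_sets: "i < m \<Longrightarrow> j < m \<Longrightarrow> scheffe_set \<mu> h i j \<in> sets \<mu>"
  unfolding scheffe_set_def using measurable_hyp[of i] measurable_hyp[of j] by measurable

lemma measure_hyp_mono:
  assumes "i < m" "j < m" "B \<in> sets \<mu>" "\<And>x. x \<in> B \<Longrightarrow> h i x \<le> h j x"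
  shows "measure (hyp \<mu> h i) B \<le> measure (hyp \<mu> h j) B"
proof -
  interpret J: prob_space "hyp \<mu> h j"
    using assms by (intro prob_space_hyp)
  have "emeasure (hyp \<mu> h i) B \<le> emeasure (hyp \<mu> h j) B"
    using assms measurable_hyp[of i] measurable_hyp[of j]
    unfolding hyp_def
    by (auto simp: emeasure_density intro!: nn_integral_mono ennreal_leI split: split_indicator)
  then show ?thesis
    unfolding measure_def by (intro enn2real_mono) (simp_all add: J.emeasure_eq_measure)
qed

text \<open>With A the Scheffe set, B and A share their intersection. Passing from B to A removes
  \<open>B - A\<close>, where the density of i is at most that of j, and adds \<open>A - B\<close>,
  where it is larger.\<close>

lemma scheffe_set_maximal_aux:
  assumes ij: "i < m" "j < m" and B: "B \<in> sets \<mu>"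
  shows "measure (hyp \<mu> h i) B - measure (hyp \<mu> h j) B
    \<le> measure (hyp \<mu> h i) (scheffe_set \<mu> h i j) - measure (hyp \<mu> h j) (scheffe_set \<mu> h i j)"
proof -
  interpret I: prob_space "hyp \<mu> h i"
    using ij by (intro prob_space_hyp)
  interpret J: prob_space "hyp \<mu> h j"
    using ij by (intro prob_space_hyp)
  let ?A = "scheffe_set \<mu> h i j"
  have A: "?A \<in> sets \<mu>"
    using ij by (rule scheffe_set_sets)
  have split: "measure (hyp \<mu> h k) C = measure (hyp \<mu> h k) (C \<inter> E) + measure (hyp \<mu> h k) (C - E)"
    if "k < m" "C \<in> sets \<mu>" "E \<in> sets \<mu>" for k C E
  proof -
    interpret K: prob_space "hyp \<mu> h k"
      using that by (intro prob_space_hyp)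
    have "measure (hyp \<mu> h k) (C \<inter> E \<union> (C - E)) = measure (hyp \<mu> h k) (C \<inter> E) + measure (hyp \<mu> h k) (C - E)"
      using that by (intro K.finite_measure_Union) auto
    then show ?thesis
      by (simp add: Int_Diff_Un)
  qed
  have "measure (hyp \<mu> h i) (B - ?A) \<le> measure (hyp \<mu> h j) (B - ?A)"
    using A B ij sets.sets_into_space[OF B]
    by (intro measure_hyp_mono) (auto simp: scheffe_set_def)
  moreover have "measure (hyp \<mu> h j) (?A - B) \<le> measure (hyp \<mu> h i) (?A - B)"
    using A B ij by (intro measure_hyp_mono) (auto simp: scheffe_set_def)
  ultimately show ?thesis
    using split[OF ij(1) B A] split[OF ij(2) B A] split[OF ij(1) A B] split[OF ij(2) A B]
    by (simp add: Int_commute)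
qed

text \<open>Complementation flips the sign of the difference of two probability measures, so the
  one-sided bound for B and for its complement gives the absolute value.\<close>

lemma scheffe_set_maximal:
  assumes ij: "i < m" "j < m" and B: "B \<in> sets \<mu>"
  shows "\<bar>measure (hyp \<mu> h i) B - measure (hyp \<mu> h j) B\<bar>
    \<le> measure (hyp \<mu> h i) (scheffe_set \<mu> h i j) - measure (hyp \<mu> h j) (scheffe_set \<mu> h i j)"
proof -
  have "measure (hyp \<mu> h k) (space \<mu> - B) = 1 - measure (hyp \<mu> h k) B" if "k < m" for k
    using prob_space.prob_compl[OF prob_space_hyp[OF that], of B] B by simp
  with scheffe_set_maximal_aux[OF ij, of "space \<mu> - B"] scheffe_set_maximal_aux[OF ij B] ij B
  show ?thesis
    by (auto simp: sets.compl_sets)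
qed

lemma hits_eq:
  assumes "i < m" "j < m"
  shows "real (hits (scheffe_access \<mu> m h n D) n i j) = (\<Sum>k<n. indicator (scheffe_set \<mu> h i j) (D k))"
  unfolding hits_def of_nat_sum
  by (intro sum.cong) (use assms in \<open>auto simp: scheffe_access_def indicator_def\<close>)

text \<open>
  The score of \<open>i\<close> controls \<open>H\<^sub>i\<close> on every Scheffe set against it, in particular on the one that
  witnesses its distance to the best hypothesis.
\<close>

lemma tv_dist_score_le:
  assumes P: "prob_space P" "sets P = sets \<mu>" and i: "i < m" and b: "b < m" and "0 < n"
    and conc: "\<And>i j. i < m \<Longrightarrow> j < m \<Longrightarrow>
      \<bar>real (hits (scheffe_access \<mu> m h n D) n i j) - real n * measure P (scheffe_set \<mu> h i j)\<bar> \<le> real n * \<tau>"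
    and score: "score (scheffe_access \<mu> m h n D) m n i
      \<le> score (scheffe_access \<mu> m h n D) m n b + real n * t"
  shows "tv_dist P (hyp \<mu> h i) \<le> 3 * tv_dist P (hyp \<mu> h b) + 2 * \<tau> + t"
proof (rule tv_dist_le)
  let ?\<Omega> = "scheffe_access \<mu> m h n D"
  let ?H = "\<lambda>i. measure (hyp \<mu> h i)" and ?A = "scheffe_set \<mu> h" and ?opt = "tv_dist P (hyp \<mu> h b)"
  note opt = measure_diff_le_tv_dist[OF P(1) prob_space_hyp[OF b]]
  have mass: "ask_mass_fst ?\<Omega> i j = ?H i (?A i j)" if "i < m" "j < m" for i j
    using that by (simp add: scheffe_access_def)
  \<comment> \<open>Nonnegativity is read off the concentration bound at the pair
    \<open>(b, b)\<close>; \<open>run_max_le\<close> needs a nonnegative bound because the maximum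
    starts at 0.\<close>
  have "0 \<le> real n * \<tau>"
    using conc[OF b b] by linarith
  have "discrepancy ?\<Omega> n b j \<le> real n * (?opt + \<tau>)" if "j < m" for j
  proof -
    have "\<bar>measure P (?A b j) - ?H b (?A b j)\<bar> \<le> ?opt"
      using scheffe_set_sets[OF b that] P by (intro opt) simp
    then have "real n * \<bar>measure P (?A b j) - ?H b (?A b j)\<bar> \<le> real n * ?opt"
      by (intro mult_left_mono) auto
    then have "\<bar>real n * measure P (?A b j) - real n * ?H b (?A b j)\<bar> \<le> real n * ?opt"
      by (simp add: abs_mult flip: right_diff_distrib)
    with conc[OF b that] show ?thesis
      unfolding discrepancy_def mass[OF b that] distrib_left by linarith
  qed
  moreover have "0 \<le> ?opt"
    using opt[of "{}"] by simp
  then have "0 \<le> real n * (?opt + \<tau>)"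
    using \<open>0 \<le> real n * \<tau>\<close> by (simp add: distrib_left)
  ultimately have "score ?\<Omega> m n b \<le> real n * (?opt + \<tau>)"
    unfolding score_def by (intro run_max_le) auto
  moreover have "discrepancy ?\<Omega> n i b \<le> score ?\<Omega> m n i"
    unfolding score_def using b by (rule run_max_ge)
  ultimately have "discrepancy ?\<Omega> n i b \<le> real n * (?opt + \<tau> + t)"
    using score by (simp add: distrib_left)
  with conc[OF i b] have "real n * ?H i (?A i b) \<le> real n * (?opt + 2 * \<tau> + t + measure P (?A i b))"
    unfolding discrepancy_def mass[OF i b] distrib_left by linarith
  \<comment> \<open>The tolerance \<tau> has entered twice, once through the score of
    \<open>b\<close> and once through the frequency of the set against \<open>i\<close>.\<close>
  then have "?H i (?A i b) \<le> ?opt + 2 * \<tau> + t + measure P (?A i b)"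
    using \<open>0 < n\<close> by (subst (asm) mult_le_cancel_left_pos) auto
  moreover have "\<bar>measure P (?A i b) - ?H b (?A i b)\<bar> \<le> ?opt"
    using scheffe_set_sets[OF i b] P by (intro opt) simp
  ultimately have gap: "?H i (?A i b) - ?H b (?A i b) \<le> 2 * ?opt + 2 * \<tau> + t"
    by linarith
  \<comment> \<open>Triangle inequality through the best hypothesis: P to H_b costs one OPT, and H_b
    to H_i is maximal on the Scheffe set, where it costs \<open>gap\<close>.\<close>
  fix B assume "B \<in> sets P"
  with scheffe_set_maximal[OF i b, of B] opt[of B] gap P
  show "\<bar>measure P B - ?H i B\<bar> \<le> 3 * ?opt + 2 * \<tau> + t"
    by simp
qed

end

section \<open>Accuracy\<close>

text \<open>The coordinates of the product are independent with law P, so the indicators are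
  independent variables in [0, 1] with mean P(A); unit ranges leave \<open>n\<close> in the
  denominator of the exponent.\<close>

lemma Hoeffding_frequency:
  fixes P :: "'x measure"
  assumes "prob_space P" and A [measurable]: "A \<in> sets P" and "0 < n" "0 \<le> t"
  shows "measure (\<Pi>\<^sub>M _\<in>{..<n}. P)
      {D \<in> space (\<Pi>\<^sub>M _\<in>{..<n}. P). t \<le> \<bar>(\<Sum>k<n. indicator A (D k)) - real n * measure P A\<bar>}
    \<le> 2 * exp (- 2 * t\<^sup>2 / real n)"
proof -
  interpret P: prob_space P
    by fact
  let ?M = "\<Pi>\<^sub>M _\<in>{..<n}. P"
  interpret M: prob_space ?M
    by (intro prob_space_PiM) (rule P.prob_space_axioms)
  have comp: "distr ?M P (\<lambda>D. D k) = P" if "k < n" for k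
    using that by (intro distr_PiM_component P.prob_space_axioms) auto
  have "M.indep_vars (\<lambda>_. P) (\<lambda>k D. D k) {..<n}"
  proof (subst M.indep_vars_iff_distr_eq_PiM')
    show "{..<n} \<noteq> {}"
      using \<open>0 < n\<close> by auto
    have "distr ?M ?M (\<lambda>D. restrict D {..<n}) = distr ?M ?M (\<lambda>D. D)"
      by (intro distr_cong) (auto simp: space_PiM)
    also have "\<dots> = ?M"
      by (simp add: distr_id)
    also have "\<dots> = (\<Pi>\<^sub>M k\<in>{..<n}. distr ?M P (\<lambda>D. D k))"
      by (intro PiM_cong) (auto simp: comp)
    finally show "distr ?M ?M (\<lambda>D. \<lambda>k\<in>{..<n}. D k) = (\<Pi>\<^sub>M k\<in>{..<n}. distr ?M P (\<lambda>D. D k))" .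
  qed auto
  then have indep: "M.indep_vars (\<lambda>_. borel) (\<lambda>k D. indicator A (D k) :: real) {..<n}"
    by (rule M.indep_vars_compose2) simp
  have "M.expectation (\<lambda>D. indicator A (D k)) = measure P A" if "k < n" for k
  proof -
    have "measure P A = integral\<^sup>L (distr ?M P (\<lambda>D. D k)) (indicator A)"
      using that by (simp add: comp)
    also have "\<dots> = M.expectation (\<lambda>D. indicator A (D k))"
      using that by (subst integral_distr) auto
    finally show ?thesis ..
  qed
  \<comment> \<open>A meta-equation, since the locale \<open>Hoeffding_ineq\<close> introduces its
    mean by a \<open>defines\<close> clause.\<close>
  then have mean: "real n * measure P A \<equiv> \<Sum>k<n. M.expectation (\<lambda>D. indicator A (D k))"
    by (intro eq_reflection) simp
  interpret J: indep_interval_bounded_random_variables ?M "{..<n}" "\<lambda>k D. indicator A (D k)"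
      "\<lambda>_. 0" "\<lambda>_. 1"
    using indep by unfold_locales auto
  interpret H: Hoeffding_ineq ?M "{..<n}" "\<lambda>k D. indicator A (D k)"
      "\<lambda>_. 0" "\<lambda>_. 1" "real n * measure P A"
    by unfold_locales (rule mean)
  show ?thesis
    using H.Hoeffding_ineq_abs_ge[OF \<open>0 \<le> t\<close>] \<open>0 < n\<close> by simp
qed

text \<open>Every bad index weighs at most \<open>exp (- (\<epsilon> * t / 2))\<close> times the
  weight of \<open>b\<close>, there are at most \<open>m\<close> of them, and the normalizing sum is
  at least the weight of \<open>b\<close>.\<close>

lemma prob_select_score_le:
  assumes "0 \<le> \<epsilon>" "0 < m" "b < m"
  shows "measure random_tape {\<omega> \<in> space random_tape. \<not> (select (weight \<Omega> m n \<epsilon>) m (\<omega> 0) < m \<and>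
      score \<Omega> m n (select (weight \<Omega> m n \<epsilon>) m (\<omega> 0)) \<le> score \<Omega> m n b + t)}
    \<le> real m * exp (- (\<epsilon> * t / 2))"
proof -
  let ?w = "weight \<Omega> m n \<epsilon>"
  let ?bad = "{i. i < m \<and> \<not> (i < m \<and> score \<Omega> m n i \<le> score \<Omega> m n b + t)}"
  have "?w i \<le> exp (- (\<epsilon> * t / 2)) * ?w b" if "i \<in> ?bad" for i
  proof -
    have "\<epsilon> * (score \<Omega> m n b + t) \<le> \<epsilon> * score \<Omega> m n i"
      using that assms by (intro mult_left_mono) auto
    then have "- (\<epsilon> * score \<Omega> m n i / 2) \<le> - (\<epsilon> * t / 2) + - (\<epsilon> * score \<Omega> m n b / 2)"
      unfolding distrib_left by linarith
    then show ?thesis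
      by (simp only: weight_def exp_le_cancel_iff flip: exp_add)
  qed
  then have "sum ?w ?bad \<le> real (card ?bad) * (exp (- (\<epsilon> * t / 2)) * ?w b)"
    by (rule sum_bounded_above)
  also have "\<dots> \<le> real m * (exp (- (\<epsilon> * t / 2)) * ?w b)"
  proof (rule mult_right_mono)
    have "card ?bad \<le> card {..<m}"
      by (intro card_mono) auto
    then show "real (card ?bad) \<le> real m"
      by simp
  qed (simp add: weight_pos less_imp_le)
  also have "\<dots> \<le> real m * (exp (- (\<epsilon> * t / 2)) * sum ?w {..<m})"
    using \<open>b < m\<close> by (intro mult_left_mono member_le_sum) (auto simp: weight_pos less_imp_le)
  finally have "sum ?w ?bad \<le> real m * exp (- (\<epsilon> * t / 2)) * sum ?w {..<m}"
    by (simp add: mult.assoc)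
  moreover have "0 < sum ?w {..<m}"
    using \<open>0 < m\<close> by (intro sum_pos) (auto simp: weight_pos)
  ultimately have "sum ?w ?bad / sum ?w {..<m} \<le> real m * exp (- (\<epsilon> * t / 2))"
    by (simp add: pos_divide_le_eq)
  then show ?thesis
    by (subst prob_select[where Q = "\<lambda>i. \<not> (i < m \<and> score \<Omega> m n i \<le> score \<Omega> m n b + t)"])
      (use assms in \<open>auto simp: weight_pos\<close>)
qed

lemma measurable_run_max [measurable]:
  assumes "\<And>i. (\<lambda>x. f x i) \<in> borel_measurable M"
  shows "(\<lambda>x. run_max (f x) N) \<in> borel_measurable M"
proof (induction N)
  case (Suc N)
  then show ?case
    using assms by simp
qed simp

text \<open>Fubini for the failure event: its sections have probability at most 1 over
  \<open>B\<close> and at most \<open>e\<close> elsewhere. Here M carries the samples and R the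
  tape.\<close>

lemma (in prob_space) prob_pair_ge:
  fixes R :: "'r measure"
  assumes R: "prob_space R" and [measurable]: "Measurable.pred (M \<Otimes>\<^sub>M R) Q" and B [measurable]: "B \<in> events"
    and bad: "\<And>x. x \<in> space M - B \<Longrightarrow> measure R {y \<in> space R. \<not> Q (x, y)} \<le> e"
    and "0 \<le> e"
  shows "1 - prob B - e \<le> measure (M \<Otimes>\<^sub>M R) {z \<in> space (M \<Otimes>\<^sub>M R). Q z}"
proof -
  interpret R: prob_space R
    by fact
  interpret MR: pair_prob_space M R ..
  let ?N = "{z \<in> space (M \<Otimes>\<^sub>M R). \<not> Q z}"
  have "emeasure (M \<Otimes>\<^sub>M R) ?N = (\<integral>\<^sup>+x. emeasure R (Pair x -` ?N) \<partial>M)"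
    by (rule R.emeasure_pair_measure_alt) measurable
  also have "\<dots> \<le> (\<integral>\<^sup>+x. indicator B x + ennreal e \<partial>M)"
  proof (rule nn_integral_mono)
    fix x assume x: "x \<in> space M"
    show "emeasure R (Pair x -` ?N) \<le> indicator B x + ennreal e"
    proof (cases "x \<in> B")
      case True
      then show ?thesis
        using R.measure_le_1[of "Pair x -` ?N"] by (simp add: add_increasing2)
    next
      case False
      have "Pair x -` ?N = {y \<in> space R. \<not> Q (x, y)}"
        using x by (auto simp: space_pair_measure)
      then show ?thesis
        using bad[of x] False x by (simp add: R.emeasure_eq_measure ennreal_leI)
    qed
  qed
  also have "\<dots> = ennreal (prob B + e)"
    using \<open>0 \<le> e\<close> by (simp add: nn_integral_add emeasure_eq_measure prob_space)
  finally have "measure (M \<Otimes>\<^sub>M R) ?N \<le> prob B + e"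
    using \<open>0 \<le> e\<close> by (subst (asm) MR.emeasure_eq_measure) (simp del: ennreal_plus)
  moreover have "measure (M \<Otimes>\<^sub>M R) ?N = 1 - measure (M \<Otimes>\<^sub>M R) {z \<in> space (M \<Otimes>\<^sub>M R). Q z}"
    by (rule MR.prob_neg) measurable
  ultimately show ?thesis
    by linarith
qed

lemma sample_bound_lower:
  assumes \<alpha>: "\<alpha> \<in> {0<..<1}" and \<beta>: "\<beta> \<in> {0<..<1}" and \<epsilon>: "\<epsilon> \<in> {0<..<1}" and m: "2 \<le> m"
    and n: "128 * sample_bound \<alpha> \<beta> \<epsilon> m \<le> real n"
  shows "0 < n"
    and "(real m)\<^sup>2 * (2 * exp (- 2 * (real n * (\<alpha> / 8))\<^sup>2 / real n)) \<le> \<beta> / 2"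
    and "real m * exp (- (\<epsilon> * (real n * (\<alpha> / 4)) / 2)) \<le> \<beta> / 2"
proof -
  define l where "l = ln (real m)"
  define b where "b = ln (1 / \<beta>)"
  define L where "L = log_inv \<alpha>"
  have b: "0 < b"
    using \<beta> by (simp add: b_def)
  have ln2: "0 < l" "ln 2 \<le> l"
    using m by (auto simp: l_def)
  have L: "1 \<le> L" "0 \<le> ln L"
    by (simp_all add: L_def log_inv_def)
  have "1 \<le> L\<^sup>2"
    using L by (simp add: one_le_power)
  have "l + b = ln (real m / \<beta>)"
    using m \<beta> by (simp add: l_def b_def ln_div)
  then have "sample_bound \<alpha> \<beta> \<epsilon> m = (l + b + ln L) / \<alpha>\<^sup>2 + (l + L\<^sup>2 * (b + ln L)) / (\<alpha> * \<epsilon>)"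
    by (simp add: sample_bound_def l_def b_def L_def)
  moreover have "(l + b) / \<alpha>\<^sup>2 \<le> (l + b + ln L) / \<alpha>\<^sup>2"
    using L by (intro divide_right_mono) auto
  moreover have "1 * (b + 0) \<le> L\<^sup>2 * (b + ln L)"
    using L b \<open>1 \<le> L\<^sup>2\<close> by (intro mult_mono) auto
  then have "(l + b) / (\<alpha> * \<epsilon>) \<le> (l + L\<^sup>2 * (b + ln L)) / (\<alpha> * \<epsilon>)"
    using \<alpha> \<epsilon> by (intro divide_right_mono) auto
  moreover have "0 < l + b"
    using ln2 b by linarith
  then have "0 < (l + b) / \<alpha>\<^sup>2" "0 < (l + b) / (\<alpha> * \<epsilon>)"
    using \<alpha> \<epsilon> by auto
  \<comment> \<open>Both summands of the sample bound are positive, so each one alone stays strictly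
    below \<open>n\<close>, which also yields \<open>0 < n\<close>.\<close>
  ultimately have n1: "128 * ((l + b) / \<alpha>\<^sup>2) < real n" and n2: "128 * ((l + b) / (\<alpha> * \<epsilon>)) < real n"
    using n by linarith+
  show "0 < n"
  proof -
    have "0 < real n"
      using n1 \<open>0 < (l + b) / \<alpha>\<^sup>2\<close> by linarith
    then show ?thesis
      by simp
  qed
  have "128 * (l + b) \<le> real n * \<alpha>\<^sup>2"
    using n1 \<alpha> by (simp add: pos_divide_less_eq)
  \<comment> \<open>The origin of 128: the union bound needs the Hoeffding exponent n alpha^2 / 32
    to reach 2 l + 2 ln 2 + b, and this is at most 4 (l + b) because ln 2 \<le> l for
    \<open>2 \<le> m\<close>.\<close>
  then have "2 * l + 2 * ln 2 + b \<le> real n * \<alpha>\<^sup>2 / 32"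
    using ln2 b by simp
  moreover have "- 2 * (real n * (\<alpha> / 8))\<^sup>2 / real n = - (real n * \<alpha>\<^sup>2 / 32)"
    using \<open>0 < n\<close> by (simp add: power2_eq_square)
  ultimately have "exp (2 * l + ln 2 + - 2 * (real n * (\<alpha> / 8))\<^sup>2 / real n) \<le> exp (- b - ln 2)"
    by simp
  then show "(real m)\<^sup>2 * (2 * exp (- 2 * (real n * (\<alpha> / 8))\<^sup>2 / real n)) \<le> \<beta> / 2"
    unfolding exp_add using m \<beta> by (simp add: l_def b_def exp_diff ln_div exp_double)
  have "128 * (l + b) \<le> real n * (\<alpha> * \<epsilon>)"
    using n2 \<alpha> \<epsilon> by (simp add: pos_divide_less_eq)
  \<comment> \<open>Stated for variables \<open>q\<close> and \<open>y\<close> so that linear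
    arithmetic does not meet the product of \<open>n\<close>, \<alpha> and \<epsilon>.\<close>
  moreover have "l + q + b \<le> y / 8" if "q \<le> l" "128 * (l + b) \<le> y" for q y
    using that \<open>0 < l\<close> b unfolding distrib_left by linarith
  ultimately have "l + ln 2 + b \<le> real n * (\<alpha> * \<epsilon>) / 8"
    using ln2 by blast
  then have "l + ln 2 + b \<le> \<epsilon> * (real n * (\<alpha> / 4)) / 2"
    by (simp add: mult_ac)
  then have "exp (l + - (\<epsilon> * (real n * (\<alpha> / 4)) / 2)) \<le> exp (- b - ln 2)"
    by simp
  then show "real m * exp (- (\<epsilon> * (real n * (\<alpha> / 4)) / 2)) \<le> \<beta> / 2"
    unfolding exp_add using m \<beta> by (simp add: l_def b_def exp_diff ln_div)
qed

context
  fixes \<mu> :: "'x measure" and m :: nat and h :: "nat \<Rightarrow> 'x \<Rightarrow> real"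
  assumes hyps: "hypothesis_class \<mu> m h" and "0 < m"
begin

lemma measurable_weight:
  assumes P: "sets P = sets \<mu>"
  shows "(\<lambda>D. weight (scheffe_access \<mu> m h n D) m n \<epsilon> i) \<in> borel_measurable (\<Pi>\<^sub>M _\<in>{..<n}. P)"
proof -
  let ?M = "\<Pi>\<^sub>M _\<in>{..<n}. P"
  have [measurable]: "(\<lambda>D. real (hits (scheffe_access \<mu> m h n D) n i j)) \<in> borel_measurable ?M" for j
  proof (cases "i < m \<and> j < m")
    case True
    then have [measurable]: "scheffe_set \<mu> h i j \<in> sets P"
      using P by (simp add: scheffe_set_sets[OF hyps])
    have "(\<lambda>D. \<Sum>k<n. indicator (scheffe_set \<mu> h i j) (D k) :: real) \<in> borel_measurable ?M"
      by measurable
    then show ?thesis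
      using True by (simp add: hits_eq[OF hyps])
  next
    \<comment> \<open>Out of range the oracle denies every membership query, so the count is
      constant.\<close>
    case False
    then have "hits (scheffe_access \<mu> m h n D) n i j = 0" for D
      unfolding hits_def by (intro sum.neutral) (auto simp: scheffe_access_def)
    then show ?thesis
      by simp
  qed
  have mass: "ask_mass_fst (scheffe_access \<mu> m h n D) i j =
      (if i < m \<and> j < m then measure (hyp \<mu> h i) (scheffe_set \<mu> h i j) else 0)" for D j
    by (simp add: scheffe_access_def)
  have "(\<lambda>D. discrepancy (scheffe_access \<mu> m h n D) n i j) \<in> borel_measurable ?M" for j
    unfolding discrepancy_def mass by measurable
  then show ?thesis
    unfolding weight_def score_def by measurable
qed

text \<open>The target \<open>c\<close> is abstract: its first lower bound serves
  \<open>2 \<le> m\<close>, the second serves \<open>m = 1\<close>, where the only hypothesis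
  attains OPT whatever the sample. In both cases a set of bad datasets of probability at most
  \<beta>/2 is exhibited, outside which the tape fails with probability at most \<beta>/2.\<close>

lemma mechanism_accurate:
  fixes P :: "'x measure"
  assumes \<alpha>: "\<alpha> \<in> {0<..<1}" and \<beta>: "\<beta> \<in> {0<..<1}" and \<epsilon>: "\<epsilon> \<in> {0<..<1}"
    and n: "128 * sample_bound \<alpha> \<beta> \<epsilon> m \<le> real n"
    and P: "prob_space P" "sets P = sets \<mu>"
    and c: "3 * tv_dist_class P (hyp \<mu> h ` {..<m}) + \<alpha> / 2 \<le> c"
      "tv_dist_class P (hyp \<mu> h ` {..<m}) \<le> c"
  shows "1 - \<beta> \<le> measure ((\<Pi>\<^sub>M _\<in>{..<n}. P) \<Otimes>\<^sub>M random_tape)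
    {(D, \<omega>) \<in> space ((\<Pi>\<^sub>M _\<in>{..<n}. P) \<Otimes>\<^sub>M random_tape).
       \<exists>i<m. output_of mechanism (scheffe_access \<mu> m h n D) \<omega> (init_state \<alpha> \<beta> \<epsilon> m n) = Some i \<and>
         tv_dist P (hyp \<mu> h i) \<le> c}"
proof -
  let ?M = "\<Pi>\<^sub>M _\<in>{..<n}. P"
  interpret M: prob_space ?M
    by (intro prob_space_PiM P)
  let ?\<Omega> = "scheffe_access \<mu> m h n"
  let ?T = "\<lambda>D \<omega>. select (weight (?\<Omega> D) m n \<epsilon>) m (\<omega> 0)"
  let ?good = "\<lambda>i. i < m \<and> tv_dist P (hyp \<mu> h i) \<le> c"
  have "(\<lambda>z. ?T (fst z) (snd z)) \<in> measurable (?M \<Otimes>\<^sub>M random_tape) (count_space UNIV)"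
    by (rule measurable_select) (use measurable_weight[OF P(2)] in measurable)
  then have meas: "Measurable.pred (?M \<Otimes>\<^sub>M random_tape) (\<lambda>z. ?good (?T (fst z) (snd z)))"
    by measurable
  \<comment> \<open>The infimum over a finite nonempty family is attained, which provides the best
    index \<open>b\<close>.\<close>
  have "tv_dist_class P (hyp \<mu> h ` {..<m}) \<in> tv_dist P ` hyp \<mu> h ` {..<m}"
    unfolding tv_dist_class_def using \<open>0 < m\<close>
    by (subst cInf_eq_Min) (auto intro!: Min_in)
  then obtain b where b: "b < m" and opt: "tv_dist_class P (hyp \<mu> h ` {..<m}) = tv_dist P (hyp \<mu> h b)"
    by auto
  have "\<exists>B\<in>sets ?M. M.prob B \<le> \<beta> / 2 \<and> (\<forall>D\<in>space ?M - B.
    measure random_tape {\<omega> \<in> space random_tape. \<not> ?good (?T D \<omega>)} \<le> \<beta> / 2)"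
  proof (cases "m = 1")
    case True
    then have "?good i" if "i < m" for i
      using b c opt that by simp
    then have "{i. i < m \<and> \<not> ?good i} = {}"
      by blast
    then have "measure random_tape {\<omega> \<in> space random_tape. \<not> ?good (?T D \<omega>)} = 0" for D
      using \<open>0 < m\<close> by (subst prob_select[where Q = "\<lambda>i. \<not> ?good i"]) (simp_all add: weight_pos)
    then show ?thesis
      using \<beta> by (intro bexI[of _ "{}"]) auto
  next
    case False
    then have "2 \<le> m"
      using \<open>0 < m\<close> by simp
    note bounds = sample_bound_lower[OF \<alpha> \<beta> \<epsilon> this n]
    let ?dev = "\<lambda>i j D. \<bar>(\<Sum>k<n. indicator (scheffe_set \<mu> h i j) (D k)) - real n * measure P (scheffe_set \<mu> h i j)\<bar>"
    let ?B = "\<lambda>ij. {D \<in> space ?M. real n * (\<alpha> / 8) \<le> ?dev (fst ij) (snd ij) D}"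
    let ?I = "{..<m} \<times> {..<m}"
    have S [measurable]: "scheffe_set \<mu> h (fst ij) (snd ij) \<in> sets P" if "ij \<in> ?I" for ij
      unfolding P(2) by (rule scheffe_set_sets[OF hyps]) (use that in \<open>simp_all add: mem_Times_iff\<close>)
    have B: "?B ij \<in> sets ?M" if "ij \<in> ?I" for ij
      using S[OF that] by measurable
    show ?thesis
    proof (intro bexI[of _ "\<Union>ij\<in>?I. ?B ij"] conjI ballI)
      show "(\<Union>ij\<in>?I. ?B ij) \<in> sets ?M"
        using B by (intro sets.finite_UN) auto
      have "M.prob (\<Union>ij\<in>?I. ?B ij) \<le> (\<Sum>ij\<in>?I. M.prob (?B ij))"
        by (rule M.finite_measure_subadditive_finite) (simp, use B in blast)
      also have "\<dots> \<le> (\<Sum>ij\<in>?I. 2 * exp (- 2 * (real n * (\<alpha> / 8))\<^sup>2 / real n))"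
        using S bounds(1) \<alpha> P(1) by (intro sum_mono Hoeffding_frequency) auto
      also have "\<dots> = (real m)\<^sup>2 * (2 * exp (- 2 * (real n * (\<alpha> / 8))\<^sup>2 / real n))"
        by (simp add: power2_eq_square)
      also have "\<dots> \<le> \<beta> / 2"
        by (rule bounds)
      finally show "M.prob (\<Union>ij\<in>?I. ?B ij) \<le> \<beta> / 2" .
    next
      fix D assume D: "D \<in> space ?M - (\<Union>ij\<in>?I. ?B ij)"
      let ?ok = "\<lambda>i. i < m \<and> score (?\<Omega> D) m n i \<le> score (?\<Omega> D) m n b + real n * (\<alpha> / 4)"
      have conc: "\<bar>real (hits (?\<Omega> D) n i j) - real n * measure P (scheffe_set \<mu> h i j)\<bar> \<le> real n * (\<alpha> / 8)"
        if "i < m" "j < m" for i j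
      proof -
        have "(i, j) \<in> ?I"
          using that by simp
        then have "D \<notin> ?B (i, j)" "D \<in> space ?M"
          using D by blast+
        then have "\<not> real n * (\<alpha> / 8) \<le> ?dev i j D"
          by simp
        then show ?thesis
          using hits_eq[OF hyps that, of n D] by simp
      qed
      \<comment> \<open>With \<tau> = \<alpha>/8 and slack \<alpha>/4 the additive error is 2
        (\<alpha>/8) + \<alpha>/4 = \<alpha>/2.\<close>
      have ok: "?good i" if "?ok i" for i
        using tv_dist_score_le[OF hyps P _ b bounds(1) conc, of i "\<alpha> / 4"] that c opt by auto
      have "{\<omega> \<in> space random_tape. \<not> ?ok (?T D \<omega>)} \<in> sets random_tape"
        by measurable
      moreover have "{\<omega> \<in> space random_tape. \<not> ?good (?T D \<omega>)}
          \<subseteq> {\<omega> \<in> space random_tape. \<not> ?ok (?T D \<omega>)}"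
        using ok by blast
      ultimately have "measure random_tape {\<omega> \<in> space random_tape. \<not> ?good (?T D \<omega>)}
        \<le> measure random_tape {\<omega> \<in> space random_tape. \<not> ?ok (?T D \<omega>)}"
        by (rule random_tape.finite_measure_mono[rotated])
      also have "\<dots> \<le> real m * exp (- (\<epsilon> * (real n * (\<alpha> / 4)) / 2))"
        using \<epsilon> b by (intro prob_select_score_le) auto
      also have "\<dots> \<le> \<beta> / 2"
        by (rule bounds)
      finally show "measure random_tape {\<omega> \<in> space random_tape. \<not> ?good (?T D \<omega>)} \<le> \<beta> / 2" .
    qed
  qed
  then obtain B where "B \<in> sets ?M" "M.prob B \<le> \<beta> / 2"
    and "\<And>D. D \<in> space ?M - B \<Longrightarrow>
      measure random_tape {\<omega> \<in> space random_tape. \<not> ?good (?T D \<omega>)} \<le> \<beta> / 2"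
    by blast
  then have "1 - M.prob B - \<beta> / 2 \<le> measure (?M \<Otimes>\<^sub>M random_tape)
      {z \<in> space (?M \<Otimes>\<^sub>M random_tape). ?good (?T (fst z) (snd z))}"
    using \<beta> by (intro M.prob_pair_ge[OF random_tape.prob_space_axioms meas]) auto
  also have "{z \<in> space (?M \<Otimes>\<^sub>M random_tape). ?good (?T (fst z) (snd z))} =
    {(D, \<omega>) \<in> space (?M \<Otimes>\<^sub>M random_tape).
       \<exists>i<m. output_of mechanism (?\<Omega> D) \<omega> (init_state \<alpha> \<beta> \<epsilon> m n) = Some i \<and>
         tv_dist P (hyp \<mu> h i) \<le> c}"
    by (auto simp: output_mechanism)
  finally show ?thesis
    using \<open>M.prob B \<le> \<beta> / 2\<close> by linarith
qed

end

theorem theorem3p5: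
  shows "\<exists>K>0. \<forall>\<zeta>>0. \<exists>C>0. \<exists>p::prog.
    \<forall>(\<alpha>::real) (\<beta>::real) (\<epsilon>::real) (m::nat) (n::nat) (\<mu>::'x measure) (h::nat \<Rightarrow> 'x \<Rightarrow> real).
      \<alpha> \<in> {0<..<1} \<longrightarrow> \<beta> \<in> {0<..<1} \<longrightarrow> \<epsilon> \<in> {0<..<1} \<longrightarrow> m \<ge> 1 \<longrightarrow> hypothesis_class \<mu> m h \<longrightarrow>
      (let s = init_state \<alpha> \<beta> \<epsilon> m n;
           T = (\<lambda>D \<omega>. output_of p (scheffe_access \<mu> m h n D) \<omega> s)
       in differentially_private \<epsilon> n \<mu> random_tape T \<and>
          (n \<ge> 1 \<longrightarrow>
             (\<forall>D\<in>datasets n \<mu>. \<forall>\<omega>\<in>space random_tape.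
                runs_within p (scheffe_access \<mu> m h n D) \<omega> s
                  (K * ((real m)\<^sup>2 * real n * log_inv \<alpha> + real n * (log_inv \<alpha>)\<^sup>2)))) \<and>
          (real n \<ge> C * sample_bound \<alpha> \<beta> \<epsilon> m \<longrightarrow>
             (\<forall>P. prob_space P \<longrightarrow> sets P = sets \<mu> \<longrightarrow>
                measure ((\<Pi>\<^sub>M _\<in>{..<n}. P) \<Otimes>\<^sub>M random_tape)
                  {(D, \<omega>) \<in> space ((\<Pi>\<^sub>M _\<in>{..<n}. P) \<Otimes>\<^sub>M random_tape).
                     \<exists>i<m. T D \<omega> = Some i \<and>
                       tv_dist P (hyp \<mu> h i)
                         \<le> 18 * (3 + \<zeta>) * tv_dist_class P (hyp \<mu> h ` {..<m}) + \<alpha>}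
                  \<ge> 1 - \<beta>)))"
proof (rule exI[of _ 113], intro conjI allI impI, simp, rule exI[of _ 128], intro conjI exI[of _ mechanism],
    simp, unfold Let_def, intro conjI allI impI ballI)
  fix \<zeta> \<alpha> \<beta> \<epsilon> :: real and m n :: nat and \<mu> :: "'x measure" and h :: "nat \<Rightarrow> 'x \<Rightarrow> real"
  assume \<zeta>: "0 < \<zeta>" and \<alpha>: "\<alpha> \<in> {0<..<1}" and \<beta>: "\<beta> \<in> {0<..<1}" and \<epsilon>: "\<epsilon> \<in> {0<..<1}"
    and m: "1 \<le> m" and hyps: "hypothesis_class \<mu> m h"
  show "differentially_private \<epsilon> n \<mu> random_tape
      (\<lambda>D \<omega>. output_of mechanism (scheffe_access \<mu> m h n D) \<omega> (init_state \<alpha> \<beta> \<epsilon> m n))"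
    using \<epsilon> m by (intro mechanism_private) auto
  show "runs_within mechanism (scheffe_access \<mu> m h n D) \<omega> (init_state \<alpha> \<beta> \<epsilon> m n)
      (113 * ((real m)\<^sup>2 * real n * log_inv \<alpha> + real n * (log_inv \<alpha>)\<^sup>2))" if "1 \<le> n" for D \<omega>
    using m that by (intro mechanism_time) auto
  fix P :: "'x measure"
  assume n: "128 * sample_bound \<alpha> \<beta> \<epsilon> m \<le> real n" and P: "prob_space P" "sets P = sets \<mu>"
  let ?opt = "tv_dist_class P (hyp \<mu> h ` {..<m})"
  have "0 \<le> ?opt"
    unfolding tv_dist_class_def
  proof (rule cINF_greatest)
    fix H assume "H \<in> hyp \<mu> h ` {..<m}"
    then show "0 \<le> tv_dist P H"
      using measure_diff_le_tv_dist[of P H "{}"] P prob_space_hyp[OF hyps] by auto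
  qed (use m in \<open>auto simp: lessThan_empty_iff\<close>)
  \<comment> \<open>Since OPT is nonnegative, both factors required by
    \<open>mechanism_accurate\<close>, 3 and 1, are dominated by 18 (3 + \<zeta>) for every positive
    \<zeta>; one program and one pair of constants thus serve all \<zeta>.\<close>
  then have "1 * ?opt \<le> 18 * (3 + \<zeta>) * ?opt" "3 * ?opt \<le> 18 * (3 + \<zeta>) * ?opt"
    using \<zeta> by (intro mult_right_mono; simp)+
  then show "1 - \<beta> \<le> measure ((\<Pi>\<^sub>M _\<in>{..<n}. P) \<Otimes>\<^sub>M random_tape)
      {(D, \<omega>) \<in> space ((\<Pi>\<^sub>M _\<in>{..<n}. P) \<Otimes>\<^sub>M random_tape).
         \<exists>i<m. output_of mechanism (scheffe_access \<mu> m h n D) \<omega> (init_state \<alpha> \<beta> \<epsilon> m n) = Some i \<and>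
           tv_dist P (hyp \<mu> h i) \<le> 18 * (3 + \<zeta>) * ?opt + \<alpha>}"
    using m \<alpha> by (intro mechanism_accurate[OF hyps _ \<alpha> \<beta> \<epsilon> n P]) auto
qed

end
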